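(* Let $a\in\mathbb{C}$ be such that the critical point $0$ of $\mathbf{f}_a$ has only one bounded forward orbit under $\mathbf{f}_a$, and this orbit is a cycle containing $0$. Then the dual Julia set $J_a^*$ is finite, and there is a neighbourhood $V$ of $a$ such that $J_c^*$ is a Cantor set for every $c\in V$ with $c\neq a$.
   Context: Fix integers $p>q\ge 1$. For $c\in\mathbb{C}$, $\mathbf{f}_c$ is the multifunction (holomorphic correspondence) of $\hat{\mathbb{C}}$ given by $\mathbf{f}_c(z)=\{w:(w-c)^q=z^p\}$ for $z\in\mathbb{C}$ and $\mathbf{f}_c(\infty)=\{\infty\}$; its critical point is $0$. A forward orbit is a sequence $(z_i)$ with $z_{i+1}\in\mathbf{f}_c(z_i)$ for all $i$. A cycle is a forward orbit which is a periodic sequence. A branch of $\mathbf{f}_c$ is a holomorphic map $\varphi$ with $(\varphi(z)-c)^q=z^p$ on its domain. A cycle $(z_i)$ of period $n$ in $\mathbb{C}$ is attracting if either some $z_i=0$ (super-attracting), or all $z_i\ne 0$ and its multiplier $\lambda=\prod_{i=0}^{n-1}\varphi_i'(z_i)$ satisfies $|\lambda|<1$, where $\varphi_i$ is a branch of $\mathbf{f}_c$ defined near $z_i$ with $\varphi_i(z_i)=z_{i+1}$. The dual Julia set $J_c^*$ is the closure of the union of all attracting cycles in $\mathbb{C}$ (i.e. excluding $\infty$).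
   Formalization: The Cantor set claim is stated only for q ≥ 2: for q = 1, f_c is the polynomial z^p + c, which has finitely many attracting cycles, so J_c^* is finite and never a Cantor set (e.g. p = 2, q = 1, a = 0). Finiteness of J_a^* is stated for all q ≥ 1. *)

theory Defs
  imports "HOL-Analysis.Analysis"
begin

(* The correspondence on the sphere maps C into C and fixes infinity, so a forward orbit meeting C
   stays in C. All objects below live in C, so infinity is not represented. *)
definition corr :: "nat \<Rightarrow> nat \<Rightarrow> complex \<Rightarrow> complex \<Rightarrow> complex set" where
  "corr p q c z = {w. (w - c) ^ q = z ^ p}"

definition forward_orbit :: "nat \<Rightarrow> nat \<Rightarrow> complex \<Rightarrow> (nat \<Rightarrow> complex) \<Rightarrow> bool" where
  "forward_orbit p q c z \<longleftrightarrow> (\<forall>i. z (Suc i) \<in> corr p q c (z i))"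

(* The period n need not be the least one. Replacing n by a multiple replaces the multiplier by a
   power, which does not affect the notion of an attracting cycle. *)
definition cycle_of_period :: "nat \<Rightarrow> nat \<Rightarrow> complex \<Rightarrow> nat \<Rightarrow> (nat \<Rightarrow> complex) \<Rightarrow> bool" where
  "cycle_of_period p q c n z \<longleftrightarrow> 0 < n \<and> forward_orbit p q c z \<and> (\<forall>i. z (i + n) = z i)"

definition is_cycle :: "nat \<Rightarrow> nat \<Rightarrow> complex \<Rightarrow> (nat \<Rightarrow> complex) \<Rightarrow> bool" where
  "is_cycle p q c z \<longleftrightarrow> (\<exists>n. cycle_of_period p q c n z)"

definition is_branch ::
  "nat \<Rightarrow> nat \<Rightarrow> complex \<Rightarrow> complex set \<Rightarrow> (complex \<Rightarrow> complex) \<Rightarrow> bool" where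
  "is_branch p q c U \<phi> \<longleftrightarrow>
     open U \<and> \<phi> holomorphic_on U \<and> (\<forall>z\<in>U. (\<phi> z - c) ^ q = z ^ p)"

(* If z i is nonzero, the branch near z i with value z (Suc i) exists and its germ is unique, so
   the existential quantifier over branches involves no choice. *)
definition attracting_cycle :: "nat \<Rightarrow> nat \<Rightarrow> complex \<Rightarrow> (nat \<Rightarrow> complex) \<Rightarrow> bool" where
  "attracting_cycle p q c z \<longleftrightarrow>
     (\<exists>n. cycle_of_period p q c n z \<and>
        ((\<exists>i. z i = 0) \<or>
         ((\<forall>i. z i \<noteq> 0) \<and>
          (\<exists>\<phi> U. (\<forall>i<n. z i \<in> U i \<and> is_branch p q c (U i) (\<phi> i) \<and> \<phi> i (z i) = z (Suc i)) \<and>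
                 norm (\<Prod>i<n. deriv (\<phi> i) (z i)) < 1))))"

(* For p > q all cycles in C lie in a bounded set, so the closures in C and in the sphere agree. *)
definition dual_julia :: "nat \<Rightarrow> nat \<Rightarrow> complex \<Rightarrow> complex set" where
  "dual_julia p q c = closure (\<Union>{range z |z. attracting_cycle p q c z})"

definition cantor_set :: "'a::metric_space set \<Rightarrow> bool" where
  "cantor_set S \<longleftrightarrow> S \<noteq> {} \<and> compact S \<and> (\<forall>x\<in>S. x islimpt S) \<and>
     (\<forall>x\<in>S. connected_component_set S x = {x})"

end

theory Submission
  imports Defs "HOL-Complex_Analysis.Complex_Analysis"
begin

text \<open>Under \<open>f\<^sub>a\<close> the critical point \<open>0\<close> returns to itself after \<open>n\<close> steps, along the cycle \<open>z\<close>, and all its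
other forward orbits escape. A compactness argument (lemma \<open>shadowing\<close>) therefore shows that for
\<open>c\<close> near \<open>a\<close> every bounded forward orbit of \<open>f\<^sub>c\<close> that starts near a point of the cycle follows the
cycle for \<open>n\<close> steps. At the points \<open>z i \<noteq> 0\<close> the correspondence has exactly one univalent branch that
follows the cycle, so the return to a neighbourhood of \<open>0\<close> has the form \<open>x \<mapsto> G (c + \<zeta>)\<close> with
\<open>\<zeta>\<^sup>q = x\<^sup>p\<close>, where \<open>G\<close> is univalent and Lipschitz with a constant that does not depend on \<open>c\<close>.
Since \<open>p > q\<close>, the modulus of \<open>\<zeta>\<close> is at most \<open>\<mu> |x|\<close>, with \<open>\<mu>\<close> as small as desired if \<open>x\<close> is small.
So all values of the return lie close to \<open>b\<^sub>c = G c\<close>, the point to which \<open>0\<close> itself returns, and the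
return contracts strongly.

Every attracting cycle passes close to \<open>0\<close>. Indeed, bounded orbits of the critical point accumulate
at each attracting cycle (\<open>attracting_cycle_attracts_critical_orbit\<close>): otherwise the inverse branches
along the cycle are defined on one fixed disc around a point of the cycle; they are uniformly bounded
because backward orbits stay bounded, whereas their derivatives at that point tend to infinity,
contrary to Cauchy's inequality. Bounded critical orbits follow \<open>z\<close>, hence so do attracting cycles.

For \<open>c = a\<close> the point \<open>b\<^sub>c\<close> is \<open>0\<close>, the return contracts towards \<open>0\<close>, and up to shifts \<open>z\<close> is the
only attracting cycle; so the dual Julia set is finite.

For \<open>c \<noteq> a\<close> near \<open>a\<close> the point \<open>b\<^sub>c\<close> is not \<open>0\<close>: the parameters for which \<open>0\<close> returns to \<open>0\<close> after \<open>n\<close>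
steps are zeros of a polynomial in \<open>c\<close>, which is not the zero polynomial because \<open>0\<close> never returns when
\<open>|c|\<close> is large (\<open>finite_return_parameters\<close>). All points of attracting cycles close to \<open>0\<close> then lie in a
disc around \<open>b\<^sub>c\<close> of radius \<open>\<epsilon> |b\<^sub>c|\<close>. This disc avoids \<open>0\<close>, and on it the \<open>q\<close>-valued power splits into \<open>q\<close>
univalent branches with disjoint images. The return becomes an iterated function system of \<open>q \<ge> 2\<close>
injective contractions with disjoint images; attracting cycles correspond to the fixed points of its
words, and the closure of the set of these fixed points is a Cantor set. The dual Julia set
consists of \<open>n\<close> homeomorphic copies of this set in disjoint discs around \<open>z 1, \<dots>, z n\<close>, hence it is a
Cantor set as well.\<close>

section \<open>Growth, bounded orbits and finite paths\<close>

text \<open>Here the inequality \<open>q < p\<close> acts: a value of the \<open>p/q\<close>-th power is negligible compared with a small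
argument, and by the next lemma it dominates a large one.\<close>
lemma norm_root_le:
  fixes x y :: complex
  assumes "1 \<le> q" "q < p" "y ^ q = x ^ p" "norm x \<le> 1" "norm x \<le> \<mu> ^ q" "0 \<le> \<mu>"
  shows "norm y \<le> \<mu> * norm x"
proof -
  have "norm y ^ q = norm x ^ p"
    using assms(3) by (metis norm_power)
  also have "\<dots> \<le> norm x ^ (Suc q)"
    using assms by (intro power_decreasing) auto
  also have "\<dots> \<le> (\<mu> * norm x) ^ q"
    using assms by (simp add: power_mult_distrib mult_right_mono)
  finally show ?thesis
    using assms by (subst (asm) power_mono_iff) auto
qed

lemma norm_root_ge:
  fixes x y :: complex
  assumes "1 \<le> q" "q < p" "y ^ q = x ^ p" "1 \<le> norm x" "\<mu> ^ q \<le> norm x" "0 \<le> \<mu>"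
  shows "\<mu> * norm x \<le> norm y"
proof -
  have "(\<mu> * norm x) ^ q \<le> norm x ^ (Suc q)"
    using assms by (simp add: power_mult_distrib mult_right_mono)
  also have "\<dots> \<le> norm x ^ p"
    using assms by (intro power_increasing) auto
  also have "\<dots> = norm y ^ q"
    using assms(3) by (metis norm_power)
  finally show ?thesis
    using assms by (subst (asm) power_mono_iff) auto
qed

text \<open>Beyond the radius \<open>max (3\<^sup>q) |c|\<close> every branch at least doubles the modulus. Thus bounded orbits stay
inside this radius, and backward orbits cannot leave any larger disc.\<close>
lemma corr_escape:
  assumes "1 \<le> q" "q < p" "w \<in> corr p q c x" "3 ^ q \<le> norm x" "norm c \<le> norm x"
  shows "2 * norm x \<le> norm w"
proof -
  have "1 \<le> (3::real) ^ q" by simp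
  then have "1 \<le> norm x" using assms(4) by linarith
  then have "3 * norm x \<le> norm (w - c)"
    using assms by (intro norm_root_ge[of q p "w - c" x 3]) (auto simp: corr_def)
  then show ?thesis
    using norm_triangle_ineq4[of w c] assms(5) by linarith
qed

definition corr_rel :: "nat \<Rightarrow> nat \<Rightarrow> complex \<Rightarrow> (complex \<times> complex) set" where
  "corr_rel p q c = {(x, y). y \<in> corr p q c x}"

definition bounded_orbit :: "nat \<Rightarrow> nat \<Rightarrow> complex \<Rightarrow> (nat \<Rightarrow> complex) \<Rightarrow> bool" where
  "bounded_orbit p q c w \<longleftrightarrow> forward_orbit p q c w \<and> bounded (range w)"

lemma bounded_orbit_norm_le:
  assumes "1 \<le> q" "q < p" "bounded_orbit p q c w" "3 ^ q \<le> R" "norm c \<le> R"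
  shows "norm (w i) \<le> R"
proof (rule ccontr)
  assume "\<not> norm (w i) \<le> R"
  then have gt: "R < norm (w i)" by simp
  have R1: "1 \<le> R" using assms(4) one_le_power[of "3::real" q] by linarith
  have grow: "2 ^ k * norm (w i) \<le> norm (w (i + k))" for k
  proof (induction k)
    case 0 then show ?case by simp
  next
    case (Suc k)
    have "norm (w i) \<le> 2 ^ k * norm (w i)"
      by (simp add: mult_le_cancel_right1)
    then have "R \<le> norm (w (i + k))" using Suc gt by linarith
    moreover have "w (i + Suc k) \<in> corr p q c (w (i + k))"
      using assms(3) by (simp add: bounded_orbit_def forward_orbit_def)
    ultimately have "2 * norm (w (i + k)) \<le> norm (w (i + Suc k))"
      using assms by (intro corr_escape[of q p]) auto
    then show ?case using Suc by simp
  qed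
  obtain M where M: "\<And>j. norm (w j) \<le> M"
    using assms(3) by (auto simp: bounded_orbit_def bounded_iff)
  obtain k where "M < 2 ^ k" using real_arch_pow[of 2 M] by auto
  moreover have "(2::real) ^ k \<le> 2 ^ k * norm (w i)" using gt R1 by simp
  ultimately show False using grow[of k] M[of "i + k"] by linarith
qed

lemma relpow_norm_le:
  assumes "1 \<le> q" "q < p" "(x, y) \<in> corr_rel p q c ^^ k" "3 ^ q \<le> R" "norm c \<le> R" "norm y \<le> R"
  shows "norm x \<le> R"
  using assms(3,6)
proof (induction k arbitrary: y)
  case 0 then show ?case by simp
next
  case (Suc k)
  then obtain t where t: "(x, t) \<in> corr_rel p q c ^^ k" "y \<in> corr p q c t"
    by (auto simp: corr_rel_def)
  have "norm t \<le> R"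
  proof (rule ccontr)
    assume "\<not> norm t \<le> R"
    then have "2 * norm t \<le> norm y" using assms t by (intro corr_escape[of q p]) auto
    then show False using \<open>\<not> norm t \<le> R\<close> Suc.prems(2) norm_ge_zero[of t] by linarith
  qed
  then show ?case using Suc.IH t by blast
qed

lemma bounded_orbit_shift:
  "bounded_orbit p q c w \<Longrightarrow> bounded_orbit p q c (\<lambda>i. w (i + j))"
  unfolding bounded_orbit_def forward_orbit_def
  by (auto intro: bounded_subset[of "range w"])

text \<open>This turns a finite path from \<open>x\<close> to a point with a bounded orbit into a bounded orbit of \<open>x\<close>. It is
used to carry the uniqueness of the bounded orbit of \<open>0\<close> to the points of the cycle, and to exclude
paths from \<open>0\<close> into the basin of an attracting cycle that misses the critical orbits.\<close>
lemma bounded_orbit_prepend: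
  assumes "(x, w 0) \<in> corr_rel p q c ^^ k" "bounded_orbit p q c w"
  shows "\<exists>u. bounded_orbit p q c u \<and> u 0 = x \<and> (\<forall>i. u (k + i) = w i)"
  using assms
proof (induction k arbitrary: w)
  case 0 then show ?case by (intro exI[of _ w]) auto
next
  case (Suc k)
  then obtain t where t: "(x, t) \<in> corr_rel p q c ^^ k" "w 0 \<in> corr p q c t"
    by (auto simp: corr_rel_def)
  define v where "v = case_nat t w"
  have "range v \<subseteq> insert t (range w)" by (auto simp: v_def split: nat.splits)
  then have "bounded_orbit p q c v" using Suc.prems t
    by (auto simp: bounded_orbit_def forward_orbit_def v_def split: nat.splits
        intro: bounded_subset[of "insert t (range w)"])
  moreover have "(x, v 0) \<in> corr_rel p q c ^^ k" using t by (simp add: v_def)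
  ultimately obtain u where u: "bounded_orbit p q c u" "u 0 = x" "\<And>i. u (k + i) = v i"
    using Suc.IH by blast
  have "u (Suc k + i) = w i" for i using u(3)[of "Suc i"] by (simp add: v_def)
  then show ?case using u by blast
qed

lemma relpow_forward_orbit:
  assumes "forward_orbit p q c w"
  shows "(w i, w (i + k)) \<in> corr_rel p q c ^^ k"
  using assms by (induction k) (auto simp: corr_rel_def forward_orbit_def)

lemma periodic_add_mult:
  fixes w :: "nat \<Rightarrow> 'a"
  assumes "\<And>i. w (i + m) = w i"
  shows "w (i + m * k) = w i"
proof (induction k)
  case (Suc k)
  then show ?case using assms[of "i + m * k"] by (simp add: algebra_simps)
qed simp

lemma cycle_bounded_orbit:
  assumes "cycle_of_period p q c m w"
  shows "bounded_orbit p q c w"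
proof -
  have per: "w (i + m) = w i" and "0 < m" for i using assms by (auto simp: cycle_of_period_def)
  have "w i = w (i mod m)" for i
    using periodic_add_mult[of w m "i mod m" "i div m", OF per] by simp
  then have "range w \<subseteq> w ` {..<m}" using \<open>0 < m\<close> by (metis image_subset_iff imageI lessThan_iff mod_less_divisor)
  then have "bounded (range w)" by (meson bounded_subset finite_imageI finite_imp_bounded finite_lessThan)
  then show ?thesis using assms by (simp add: bounded_orbit_def cycle_of_period_def)
qed

lemma cycle_shift:
  assumes "cycle_of_period p q c m w"
  shows "cycle_of_period p q c m (\<lambda>i. w (i + j))"
proof -
  have "w (i + m + j) = w (i + j)" for i
    using assms by (simp add: cycle_of_period_def add.assoc add.commute[of m])
      (metis add.assoc)
  then show ?thesis using assms by (simp add: cycle_of_period_def forward_orbit_def)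
qed

lemma cycle_range_shift:
  assumes "cycle_of_period p q c m w"
  shows "range (\<lambda>i. w (i + j)) = range w"
proof -
  have per: "w (i + m) = w i" and "0 < m" for i using assms by (auto simp: cycle_of_period_def)
  have "w i \<in> range (\<lambda>i. w (i + j))" for i
  proof -
    have "j \<le> i + m * j" using \<open>0 < m\<close> by (cases m) auto
    then have "w i = w ((i + m * j - j) + j)" using periodic_add_mult[of w m i j, OF per] by simp
    then show ?thesis by blast
  qed
  then show ?thesis by auto
qed

section \<open>Branches of the fractional power near 1\<close>

text \<open>The branch of the multivalued \<open>p/q\<close>-th power that maps \<open>1\<close> to \<open>1\<close>. All branches of the correspondence
are obtained from it by scaling: near \<open>x \<noteq> 0\<close> the branch with value \<open>w\<close> at \<open>x\<close> is
\<open>c + (w - c) * frac_power p q (u / x)\<close>.\<close>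
definition frac_power :: "nat \<Rightarrow> nat \<Rightarrow> complex \<Rightarrow> complex" where
  "frac_power p q u = u powr (of_nat p / of_nat q)"

lemma frac_power_power:
  assumes "1 \<le> q" "1 \<le> p"
  shows "frac_power p q u ^ q = u ^ p"
proof (cases "u = 0")
  case False
  then have "frac_power p q u ^ q = u powr (of_nat q * (of_nat p / of_nat q))"
    by (simp add: frac_power_def powr_def exp_of_nat_mult[symmetric])
  then show ?thesis using False assms by simp
qed (use assms in \<open>simp add: frac_power_def zero_power\<close>)

lemma frac_power_1 [simp]: "frac_power p q 1 = 1"
  by (simp add: frac_power_def)

lemma frac_power_eq_0_iff [simp]: "frac_power p q u = 0 \<longleftrightarrow> u = 0"
  by (simp add: frac_power_def)

lemma Re_pos_near_1: "norm (u - 1) < 1 \<Longrightarrow> 0 < Re u"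
  using abs_Re_le_cmod[of "u - 1"] by auto

lemma frac_power_deriv:
  assumes "norm (u - 1) < 1"
  shows "(frac_power p q has_field_derivative
    (of_nat p / of_nat q) * frac_power p q u / u) (at u)"
proof -
  have "u \<notin> \<real>\<^sub>\<le>\<^sub>0" "u \<noteq> 0" using Re_pos_near_1[OF assms] by (auto simp: complex_nonpos_Reals_iff)
  then show ?thesis
    using has_field_derivative_powr[of u "of_nat p / of_nat q"]
    unfolding frac_power_def by (simp add: powr_diff)
qed

lemma frac_power_Lipschitz:
  obtains K where "0 < K" "\<And>u u'. \<lbrakk>norm (u - 1) \<le> 1/2; norm (u' - 1) \<le> 1/2\<rbrakk>
     \<Longrightarrow> norm (frac_power p q u - frac_power p q u') \<le> K * norm (u - u')"
proof -
  define S :: "complex set" where "S = cball 1 (1/2)"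
  define f' where "f' = (\<lambda>u. (of_nat p / of_nat q) * frac_power p q u / u)"
  have mem: "u \<in> S \<longleftrightarrow> norm (u - 1) \<le> 1/2" for u
    by (simp add: S_def dist_norm norm_minus_commute)
  have der: "(frac_power p q has_field_derivative f' u) (at u)" if "u \<in> S" for u
    unfolding f'_def using that by (intro frac_power_deriv) (simp add: mem)
  have "u \<noteq> 0" if "u \<in> S" for u using that by (auto simp: mem)
  moreover have "continuous_on S (frac_power p q)"
    using der by (meson DERIV_isCont continuous_at_imp_continuous_on)
  ultimately have "continuous_on S f'" unfolding f'_def by (intro continuous_intros) auto
  then have "compact (f' ` S)" by (intro compact_continuous_image) (auto simp: S_def)
  then have "bounded (f' ` S)" by (rule compact_imp_bounded)
  then obtain B where B: "0 < B" "\<And>u. u \<in> S \<Longrightarrow> norm (f' u) \<le> B"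
    unfolding bounded_pos by auto
  have "norm (frac_power p q u - frac_power p q u') \<le> B * norm (u - u')" if "u \<in> S" "u' \<in> S" for u u'
    using B(2) der that
    by (intro field_differentiable_bound[of S]) (auto simp: S_def intro: has_field_derivative_at_within)
  then show ?thesis using that[of B] B(1) mem by blast
qed

lemma roots_unity_isolated:
  assumes "1 \<le> (k::nat)"
  obtains \<tau> where "0 < \<tau>" "\<And>x::complex. \<lbrakk>x ^ k = 1; norm (x - 1) < \<tau>\<rbrakk> \<Longrightarrow> x = 1"
proof -
  have "finite {x::complex. x ^ k = 1}" using assms by (intro finite_roots_unity) auto
  then obtain d where "d > 0" "\<forall>x\<in>{x::complex. x ^ k = 1}. x \<noteq> 1 \<longrightarrow> d \<le> dist 1 x"
    using finite_set_avoid by blast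
  then show ?thesis using that[of d] by (force simp: dist_norm norm_minus_commute)
qed

text \<open>Distinct roots of unity keep a positive distance. Hence near \<open>1\<close> the \<open>q\<close> branches of the power have
disjoint images, each branch is injective, and the equation \<open>y\<^sup>q = u\<^sup>p\<close> has only the principal solution
\<open>y\<close> near \<open>1\<close>.\<close>
lemma frac_power_separation:
  assumes "1 \<le> q" "1 \<le> p"
  obtains \<epsilon> where "0 < \<epsilon>" "\<epsilon> \<le> 1/2"
    "\<And>u. norm (u - 1) \<le> \<epsilon> \<Longrightarrow> norm (frac_power p q u) \<le> 2"
    "\<And>\<omega> u u'. \<lbrakk>\<omega> ^ q = 1; norm (u - 1) \<le> \<epsilon>; norm (u' - 1) \<le> \<epsilon>;
        \<omega> * frac_power p q u = frac_power p q u'\<rbrakk> \<Longrightarrow> \<omega> = 1 \<and> u = u'"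
    "\<And>y u. \<lbrakk>norm (y - 1) \<le> \<epsilon>; norm (u - 1) \<le> \<epsilon>; y ^ q = u ^ p\<rbrakk> \<Longrightarrow> y = frac_power p q u"
proof -
  obtain \<tau>q where \<tau>q: "0 < \<tau>q" "\<And>x::complex. \<lbrakk>x ^ q = 1; norm (x - 1) < \<tau>q\<rbrakk> \<Longrightarrow> x = 1"
    using roots_unity_isolated[OF assms(1)] by blast
  obtain \<tau>p where \<tau>p: "0 < \<tau>p" "\<And>x::complex. \<lbrakk>x ^ p = 1; norm (x - 1) < \<tau>p\<rbrakk> \<Longrightarrow> x = 1"
    using roots_unity_isolated[OF assms(2)] by blast
  obtain K where K: "0 < K" "\<And>u u'. \<lbrakk>norm (u - 1) \<le> 1/2; norm (u' - 1) \<le> 1/2\<rbrakk>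
     \<Longrightarrow> norm (frac_power p q u - frac_power p q u') \<le> K * norm (u - u')"
    using frac_power_Lipschitz by blast
  define \<tau> where "\<tau> = min \<tau>p \<tau>q"
  define \<epsilon> where "\<epsilon> = min (1/2) (min (1/(2*K)) (min (\<tau>/8) (\<tau>/(8*K))))"
  have \<tau>: "0 < \<tau>" using \<tau>p \<tau>q by (simp add: \<tau>_def)
  have \<epsilon>: "0 < \<epsilon>" "\<epsilon> \<le> 1/2" using \<tau> K by (auto simp: \<epsilon>_def)
  have \<epsilon>': "K * \<epsilon> \<le> 1/2" "\<epsilon> \<le> \<tau>/8" "K * \<epsilon> \<le> \<tau>/8"
  proof -
    have "\<epsilon> \<le> 1/(2*K)" "\<epsilon> \<le> \<tau>/(8*K)" by (auto simp: \<epsilon>_def)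
    then show "K * \<epsilon> \<le> 1/2" "K * \<epsilon> \<le> \<tau>/8" using K(1) by (auto simp: field_simps)
    show "\<epsilon> \<le> \<tau>/8" by (auto simp: \<epsilon>_def)
  qed
  have T1: "norm (frac_power p q u - 1) \<le> K * \<epsilon>" if "norm (u - 1) \<le> \<epsilon>" for u
  proof -
    have "norm (frac_power p q u - frac_power p q 1) \<le> K * norm (u - 1)"
      using that \<epsilon> by (intro K(2)) auto
    also have "\<dots> \<le> K * \<epsilon>" using K(1) that by (intro mult_left_mono) auto
    finally show ?thesis by simp
  qed
  have div1: "norm (x / y - 1) < \<tau>"
    if "norm (x - 1) \<le> s" "norm (y - 1) \<le> s" "s \<le> 1/2" "s \<le> \<tau>/8" for x y :: complex and s
  proof -
    have y: "1/2 \<le> norm y" using that norm_triangle_ineq2[of 1 "1 - y"] by (simp add: norm_minus_commute)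
    then have "y \<noteq> 0" by auto
    then have "x / y - 1 = (x - y) / y" by (simp add: field_simps)
    then have "norm (x / y - 1) = norm (x - y) / norm y" by (simp add: norm_divide)
    also have "\<dots> \<le> norm (x - y) / (1/2)" using y by (intro divide_left_mono) auto
    also have "norm (x - y) \<le> 2 * s"
      using norm_triangle_ineq4[of "x - 1" "y - 1"] that by simp
    finally show ?thesis using that \<tau> by simp
  qed
  have nz: "u \<noteq> 0" if "norm (u - 1) \<le> \<epsilon>" for u :: complex using that \<epsilon> by auto
  have A: "\<omega> = 1 \<and> u = u'"
    if "\<omega> ^ q = 1" and u: "norm (u - 1) \<le> \<epsilon>" "norm (u' - 1) \<le> \<epsilon>"
      and eq: "\<omega> * frac_power p q u = frac_power p q u'" for \<omega> u u'
  proof -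
    have "\<omega> = frac_power p q u' / frac_power p q u"
      using eq nz u by (simp add: field_simps)
    then have "norm (\<omega> - 1) < \<tau>" using div1 T1 u \<epsilon>' by blast
    then have \<omega>: "\<omega> = 1" using that(1) \<tau>q by (simp add: \<tau>_def)
    then have "u' ^ p = u ^ p"
      using eq frac_power_power[OF assms, of u] frac_power_power[OF assms, of u'] by simp
    then have "(u' / u) ^ p = 1" using nz u by (simp add: power_divide)
    moreover have "norm (u' / u - 1) < \<tau>" using div1 u \<epsilon> \<epsilon>' by blast
    ultimately have "u' / u = 1" using \<tau>p(2)[of "u' / u"] unfolding \<tau>_def by simp
    then show ?thesis using \<omega> nz u by (simp add: field_simps)
  qed
  have B: "y = frac_power p q u"
    if y: "norm (y - 1) \<le> \<epsilon>" and u: "norm (u - 1) \<le> \<epsilon>" and "y ^ q = u ^ p" for y u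
  proof -
    have "(y / frac_power p q u) ^ q = 1"
      using that nz frac_power_power[OF assms, of u] by (simp add: power_divide)
    moreover have "norm (y / frac_power p q u - 1) < \<tau>"
      using div1[of y "max \<epsilon> (K * \<epsilon>)" "frac_power p q u"] T1[OF u] y \<epsilon> \<epsilon>' by simp
    ultimately have "y / frac_power p q u = 1"
      using \<tau>q(2)[of "y / frac_power p q u"] unfolding \<tau>_def by simp
    then show ?thesis using nz u by (simp add: field_simps)
  qed
  have "norm (frac_power p q u) \<le> 2" if "norm (u - 1) \<le> \<epsilon>" for u
    using T1[OF that] \<epsilon>' norm_triangle_ineq2[of "frac_power p q u" 1] by simp
  then show ?thesis using that[of \<epsilon>] \<epsilon> A B by blast
qed

section \<open>Parameters for which the critical point returns to itself\<close>

text \<open>A polynomial with polynomial coefficients is read as a polynomial in two variables: the coefficients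
are polynomials in the parameter \<open>c\<close>, and the outer variable is the phase variable \<open>y\<close>.\<close>
definition eval2 :: "complex poly poly \<Rightarrow> complex \<Rightarrow> complex \<Rightarrow> complex" where
  "eval2 P c y = poly (poly P [:y:]) c"

lemma poly_poly_eval: "poly (poly P r) c = eval2 P c (poly r c)"
proof (induction P)
  case (pCons a P)
  have "poly (poly (pCons a P) r) c = poly a c + poly r c * eval2 P c (poly r c)"
    by (simp only: poly_pCons poly_add poly_mult pCons.IH)
  also have "\<dots> = eval2 (pCons a P) c (poly r c)"
    by (simp add: eval2_def)
  finally show ?case .
qed (simp add: eval2_def)

lemma eval2_pcompose: "eval2 (pcompose P Q) c y = eval2 P c (eval2 Q c y)"
  unfolding eval2_def[of "pcompose P Q"] poly_pcompose poly_poly_eval by (simp add: eval2_def)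

text \<open>Comparing coefficients, \<open>\<omega>\<^sup>i\<close> fixes the \<open>i\<close>-th coefficient; if \<open>q\<close> does not divide \<open>i\<close>, a primitive root
of unity \<open>\<omega>\<close> forces this coefficient to vanish.\<close>
lemma poly_in_power_if_invariant:
  fixes Q :: "complex poly poly"
  assumes "1 \<le> q" and inv: "\<And>\<omega>. \<omega> ^ q = 1 \<Longrightarrow> pcompose Q [:0, [:\<omega>:]:] = Q"
  shows "\<exists>R. \<forall>s. poly R (s ^ q) = poly Q s"
proof -
  have zero: "coeff Q i = 0" if "\<not> q dvd i" for i
  proof -
    define \<omega> where "\<omega> = exp (2 * of_real pi * \<i> * of_nat 1 / of_nat q)"
    have "\<omega> ^ q = 1" using assms(1) by (simp add: \<omega>_def exp_of_nat_mult[symmetric])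
    then have "coeff Q i = [:\<omega>:] ^ i * coeff Q i"
      using inv[of \<omega>] coeff_pcompose_linear[of Q "[:\<omega>:]" i] by metis
    then have "([:\<omega>:] ^ i - 1) * coeff Q i = 0" by (simp add: algebra_simps)
    moreover have "[:\<omega>:] ^ i \<noteq> 1"
    proof
      assume "[:\<omega>:] ^ i = 1"
      then have "poly ([:\<omega>:] ^ i) 0 = 1" by simp
      then have "\<omega> ^ i = 1" by simp
      then have "exp (2 * of_real pi * \<i> * of_nat i / of_nat q) = 1"
        by (simp add: \<omega>_def exp_of_nat_mult[symmetric] mult_ac)
      then show False using complex_root_unity_eq_1[OF assms(1), of i] that by blast
    qed
    ultimately show ?thesis by simp
  qed
  define R where "R = (\<Sum>i\<le>degree Q. monom (coeff Q (q * i)) i)"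
  have "poly R (s ^ q) = poly Q s" for s
  proof -
    let ?f = "\<lambda>i. coeff Q i * s ^ i"
    have "poly R (s ^ q) = (\<Sum>i\<le>degree Q. ?f (q * i))"
      by (simp add: R_def poly_sum poly_monom power_mult)
    also have "\<dots> = (\<Sum>i\<in>(*) q ` {..degree Q}. ?f i)"
      using assms(1) by (subst sum.reindex) (auto simp: inj_on_def)
    also have "\<dots> = (\<Sum>i\<le>q * degree Q. ?f i)"
    proof (rule sum.mono_neutral_left)
      show "\<forall>i\<in>{..q * degree Q} - (*) q ` {..degree Q}. ?f i = 0"
      proof
        fix i assume i: "i \<in> {..q * degree Q} - (*) q ` {..degree Q}"
        have "\<not> q dvd i" using i assms(1) by (auto elim!: dvdE)
        then show "?f i = 0" by (simp add: zero)
      qed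
    qed auto
    also have "\<dots> = (\<Sum>i\<le>degree Q. ?f i)"
      using assms(1) by (intro sum.mono_neutral_right) (auto simp: coeff_eq_0)
    finally show ?thesis by (simp add: poly_altdef)
  qed
  then show ?thesis by blast
qed

text \<open>Elimination of the image point \<open>w\<close>. With \<open>w = c + t\<close> and \<open>t\<^sup>q = y\<^sup>p\<close>, the product of \<open>P c (c + \<omega> t)\<close>
over the \<open>q\<close>-th roots of unity \<open>\<omega>\<close> vanishes if and only if \<open>P\<close> vanishes at one of the images of \<open>y\<close>; it
is invariant under \<open>t \<mapsto> \<omega> t\<close>, hence a polynomial in \<open>t\<^sup>q = y\<^sup>p\<close>.\<close>
lemma corr_image_vanishing_poly:
  assumes q: "1 \<le> q" and p: "1 \<le> p"
  shows "\<exists>P'. \<forall>c y. eval2 P' c y = 0 \<longleftrightarrow> (\<exists>w\<in>corr p q c y. eval2 P c w = 0)"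
proof -
  define U where "U = {\<omega>::complex. \<omega> ^ q = 1}"
  have finU: "finite U" using q by (auto simp: U_def intro: finite_roots_unity)
  define P0 where "P0 = pcompose P [:[:0, 1:], 1:]"
  define Q where "Q = (\<Prod>\<omega>\<in>U. pcompose P0 [:0, [:\<omega>:]:])"
  have P0: "eval2 P0 c t = eval2 P c (c + t)" for c t
    unfolding P0_def eval2_pcompose by (simp add: eval2_def add.commute)
  have Q: "eval2 Q c t = (\<Prod>\<omega>\<in>U. eval2 P c (c + \<omega> * t))" for c t
  proof -
    have "eval2 Q c t = (\<Prod>\<omega>\<in>U. eval2 (pcompose P0 [:0, [:\<omega>:]:]) c t)"
      by (simp add: Q_def eval2_def poly_prod)
    also have "\<dots> = (\<Prod>\<omega>\<in>U. eval2 P c (c + \<omega> * t))"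
      unfolding eval2_pcompose P0 by (simp add: eval2_def mult.commute)
    finally show ?thesis .
  qed
  have "pcompose Q [:0, [:\<eta>:]:] = Q" if "\<eta> ^ q = 1" for \<eta>
  proof -
    have "\<eta> \<noteq> 0" using that q by (auto simp: zero_power)
    have "pcompose Q [:0, [:\<eta>:]:] = (\<Prod>\<omega>\<in>U. pcompose P0 [:0, [:\<omega> * \<eta>:]:])"
      unfolding Q_def pcompose_prod
    proof (rule prod.cong[OF refl])
      fix \<omega> show "pcompose (pcompose P0 [:0, [:\<omega>:]:]) [:0, [:\<eta>:]:] = pcompose P0 [:0, [:\<omega> * \<eta>:]:]"
        unfolding pcompose_assoc[symmetric] by (simp add: pcompose_pCons mult.commute)
    qed
    also have "\<dots> = Q" unfolding Q_def
      by (rule prod.reindex_bij_witness[of _ "\<lambda>\<omega>. \<omega> / \<eta>" "\<lambda>\<omega>. \<omega> * \<eta>"])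
        (use that \<open>\<eta> \<noteq> 0\<close> in \<open>auto simp: U_def power_mult_distrib power_divide\<close>)
    finally show ?thesis .
  qed
  then obtain R where R: "\<And>s. poly R (s ^ q) = poly Q s"
    using poly_in_power_if_invariant[OF q, of Q] by blast
  define P' where "P' = pcompose R (monom 1 p)"
  have "eval2 P' c y = 0 \<longleftrightarrow> (\<exists>w\<in>corr p q c y. eval2 P c w = 0)" for c y
  proof -
    obtain t where t: "t ^ q = y ^ p"
      using frac_power_power[OF q, of p y] p by blast
    have "eval2 P' c y = poly (poly R ([:y:] ^ p)) c"
      by (simp add: P'_def eval2_def poly_pcompose poly_monom)
    also have "\<dots> = poly (poly R ([:t:] ^ q)) c"
      using t by (simp only: poly_poly_eval poly_power) simp
    also have "\<dots> = eval2 Q c t" using R by (simp add: eval2_def)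
    finally have "eval2 P' c y = 0 \<longleftrightarrow> (\<exists>\<omega>\<in>U. eval2 P c (c + \<omega> * t) = 0)"
      using Q finU by simp
    moreover have "(\<exists>\<omega>\<in>U. eval2 P c (c + \<omega> * t) = 0) \<longleftrightarrow> (\<exists>w\<in>corr p q c y. eval2 P c w = 0)"
    proof
      assume "\<exists>\<omega>\<in>U. eval2 P c (c + \<omega> * t) = 0"
      then show "\<exists>w\<in>corr p q c y. eval2 P c w = 0"
        using t by (force simp: corr_def U_def power_mult_distrib)
    next
      assume "\<exists>w\<in>corr p q c y. eval2 P c w = 0"
      then obtain w where w: "(w - c) ^ q = t ^ q" "eval2 P c w = 0" using t by (auto simp: corr_def)
      show "\<exists>\<omega>\<in>U. eval2 P c (c + \<omega> * t) = 0"
      proof (cases "t = 0")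
        case True
        then have "w = c" using w q by (simp add: power_0_left)
        then show ?thesis using True w by (intro bexI[of _ 1]) (auto simp: U_def)
      next
        case False
        then show ?thesis using w
          by (intro bexI[of _ "(w - c) / t"]) (auto simp: U_def power_divide)
      qed
    qed
    ultimately show ?thesis by blast
  qed
  then show ?thesis by blast
qed

lemma return_vanishing_poly:
  assumes "1 \<le> q" "1 \<le> p"
  shows "\<exists>P. \<forall>c y. eval2 P c y = 0 \<longleftrightarrow> (y, 0) \<in> corr_rel p q c ^^ k"
proof (induction k)
  case 0
  have "eval2 [:0, 1:] c y = y" for c y by (simp add: eval2_def)
  then show ?case by (intro exI[of _ "[:0, 1:]"]) auto
next
  case (Suc k)
  then obtain P where P: "\<And>c y. eval2 P c y = 0 \<longleftrightarrow> (y, 0) \<in> corr_rel p q c ^^ k" by blast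
  obtain P' where P': "\<And>c y. eval2 P' c y = 0 \<longleftrightarrow> (\<exists>w\<in>corr p q c y. eval2 P c w = 0)"
    using corr_image_vanishing_poly[OF assms, of P] by blast
  have "eval2 P' c y = 0 \<longleftrightarrow> (y, 0) \<in> corr_rel p q c ^^ Suc k" for c y
  proof -
    have "(y, 0) \<in> corr_rel p q c ^^ Suc k \<longleftrightarrow> (\<exists>w. (y, w) \<in> corr_rel p q c \<and> (w, 0) \<in> corr_rel p q c ^^ k)"
      by (meson relpow_Suc_D2 relpow_Suc_I2)
    then show ?thesis unfolding P' P by (auto simp: corr_rel_def)
  qed
  then show ?case by blast
qed

text \<open>For \<open>|c| \<ge> 2\<^sup>q\<close> the first step leads from \<open>0\<close> to \<open>c\<close>, and a point of modulus at least \<open>|c|\<close> is mapped to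
points \<open>w\<close> with \<open>|w - c| \<ge> 2 |c|\<close>. So the orbit never comes closer to \<open>0\<close> than \<open>|c|\<close>.\<close>
lemma no_return_large_parameter:
  assumes "1 \<le> q" "q < p" "2 ^ q \<le> norm c" "1 \<le> k" "(0, y) \<in> corr_rel p q c ^^ k"
  shows "norm c \<le> norm y"
  using assms(4,5)
proof (induction k arbitrary: y rule: nat_induct_at_least)
  case base
  then show ?case using assms by (auto simp: corr_rel_def corr_def zero_power)
next
  case (Suc k)
  then obtain t where t: "(0, t) \<in> corr_rel p q c ^^ k" "y \<in> corr p q c t"
    by (auto simp: corr_rel_def)
  have "1 \<le> (2::real) ^ q" by simp
  then have "1 \<le> norm t" "2 ^ q \<le> norm t" using Suc.IH[OF t(1)] assms by linarith+
  then have "2 * norm t \<le> norm (y - c)"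
    using t assms by (intro norm_root_ge[of q p]) (auto simp: corr_def)
  then show ?case using Suc.IH[OF t(1)] norm_triangle_ineq4[of y c] by linarith
qed

lemma finite_return_parameters:
  assumes "1 \<le> q" "q < p" "1 \<le> k"
  shows "finite {c. (0, 0) \<in> corr_rel p q c ^^ k}"
proof -
  obtain P where P: "\<And>c y. eval2 P c y = 0 \<longleftrightarrow> (y, 0) \<in> corr_rel p q c ^^ k"
    using return_vanishing_poly[OF assms(1), of p] assms(2) by force
  define h where "h = poly P [:0:]"
  have h: "poly h c = 0 \<longleftrightarrow> (0, 0) \<in> corr_rel p q c ^^ k" for c
    using P[of c 0] by (simp add: eval2_def h_def)
  have "(0, 0) \<notin> corr_rel p q (2 ^ q) ^^ k"
  proof
    assume "(0, 0) \<in> corr_rel p q (2 ^ q) ^^ k"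
    then have "norm (2 ^ q :: complex) \<le> norm (0 :: complex)"
      using no_return_large_parameter[OF assms(1,2) _ assms(3), of "2 ^ q" 0] by (simp add: norm_power)
    then show False by (simp only: norm_zero norm_le_zero_iff) simp
  qed
  then have "h \<noteq> 0" using h[of "2 ^ q"] by (metis poly_0)
  then show ?thesis using poly_roots_finite[of h] h by simp
qed

section \<open>Limit sets of separated iterated function systems\<close>

text \<open>For the return of the correspondence these are the points at which attracting cycles meet the disc
\<open>B\<close>, the letters of the word being the branches chosen at the successive returns.\<close>
definition word_fixpoints :: "('i \<Rightarrow> 'a \<Rightarrow> 'a) \<Rightarrow> 'i set \<Rightarrow> 'a set \<Rightarrow> 'a set" where
  "word_fixpoints E I B = {x \<in> B. \<exists>js. js \<noteq> [] \<and> set js \<subseteq> I \<and> fold E js x = x}"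

text \<open>The assumption \<open>sep\<close> combines injectivity of each map with disjointness of the images of different
maps. The former transports connected sets backwards; the latter confines a connected subset
of the limit set to the image of a single map.\<close>
locale separated_ifs =
  fixes E :: "'i \<Rightarrow> 'a::{heine_borel,complete_space} \<Rightarrow> 'a" and I :: "'i set" and B :: "'a set" and \<kappa> :: real
  assumes I: "finite I" "2 \<le> card I"
    and B: "compact B" "B \<noteq> {}"
    and \<kappa>: "0 \<le> \<kappa>" "\<kappa> < 1"
    and maps: "\<And>j x. j \<in> I \<Longrightarrow> x \<in> B \<Longrightarrow> E j x \<in> B"
    and contr: "\<And>j x y. \<lbrakk>j \<in> I; x \<in> B; y \<in> B\<rbrakk> \<Longrightarrow> dist (E j x) (E j y) \<le> \<kappa> * dist x y"
    and sep: "\<And>j k x y. \<lbrakk>j \<in> I; k \<in> I; x \<in> B; y \<in> B; E j x = E k y\<rbrakk> \<Longrightarrow> j = k \<and> x = y"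
begin

lemma word_maps: "set js \<subseteq> I \<Longrightarrow> x \<in> B \<Longrightarrow> fold E js x \<in> B"
  by (induction js arbitrary: x) (auto simp: maps)

lemma word_contr:
  "\<lbrakk>set js \<subseteq> I; x \<in> B; y \<in> B\<rbrakk> \<Longrightarrow> dist (fold E js x) (fold E js y) \<le> \<kappa> ^ length js * dist x y"
proof (induction js arbitrary: x y)
  case (Cons j js)
  have "dist (fold E js (E j x)) (fold E js (E j y)) \<le> \<kappa> ^ length js * dist (E j x) (E j y)"
    using Cons maps by auto
  also have "\<dots> \<le> \<kappa> ^ length js * (\<kappa> * dist x y)"
    using Cons contr \<kappa> by (intro mult_left_mono) auto
  finally show ?case by (simp add: mult_ac)
qed simp

lemma word_inj: "\<lbrakk>set js \<subseteq> I; x \<in> B; y \<in> B; fold E js x = fold E js y\<rbrakk> \<Longrightarrow> x = y"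
proof (induction js arbitrary: x y)
  case (Cons j js)
  then have "E j x = E j y" using maps by auto
  then show ?case using sep[of j j x y] Cons by auto
qed simp

lemma word_fixpoint_exists:
  assumes "set js \<subseteq> I" "js \<noteq> []"
  obtains x where "x \<in> B" "fold E js x = x"
proof -
  have "\<kappa> ^ length js \<le> \<kappa> ^ 1" using assms \<kappa> by (intro power_decreasing) (auto simp: Suc_le_eq)
  then have l: "\<kappa> ^ length js < 1" "0 \<le> \<kappa> ^ length js" using \<kappa> by auto
  have "\<exists>!x\<in>B. fold E js x = x"
    using l B assms word_maps word_contr
    by (intro Banach_fix[where c = "\<kappa> ^ length js"]) (auto intro: compact_imp_complete)
  then show ?thesis using that by blast
qed

abbreviation "P \<equiv> word_fixpoints E I B"

lemma word_fixpoints_subset: "P \<subseteq> B" by (auto simp: word_fixpoints_def)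

lemma limit_set_subset: "closure P \<subseteq> B"
  using word_fixpoints_subset B by (simp add: closure_minimal compact_imp_closed)

lemma limit_set_compact: "compact (closure P)"
  using limit_set_subset B by (meson closed_closure closed_subset compact_Int_closed compact_eq_bounded_closed
      bounded_subset)

text \<open>The form in which fixed points of words arise from, and give rise to, cycles of a correspondence.\<close>
lemma word_fixpoint_iff_periodic:
  "x \<in> word_fixpoints E I B \<longleftrightarrow> (\<exists>N>0. \<exists>v. v 0 = x \<and> (\<forall>k. v k \<in> B \<and> (\<exists>j\<in>I. v (Suc k) = E j (v k))) \<and> (\<forall>k. v (k + N) = v k))"
  (is "?L \<longleftrightarrow> ?R")
proof
  assume ?L
  then obtain js where x: "x \<in> B" and js: "js \<noteq> []" "set js \<subseteq> I" "fold E js x = x"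
    by (auto simp: word_fixpoints_def)
  define N where "N = length js"
  have N: "0 < N" using js by (simp add: N_def)
  define v where "v = rec_nat x (\<lambda>k y. E (js ! (k mod N)) y)"
  have v: "v 0 = x" "v (Suc k) = E (js ! (k mod N)) (v k)" for k by (simp_all add: v_def)
  have letter: "js ! (k mod N) \<in> I" for k using js N by (metis N_def mod_less_divisor nth_mem subsetD)
  have vB: "v k \<in> B" for k by (induction k) (auto simp: v x letter maps)
  have "v k = fold E (take k js) x" if "k \<le> N" for k
    using that
  proof (induction k)
    case (Suc k)
    then have "take (Suc k) js = take k js @ [js ! k]" by (simp add: N_def take_Suc_conv_app_nth)
    then show ?case using Suc by (simp add: v)
  qed (simp add: v)
  then have "v N = x" using js by (simp add: N_def)
  then have "v (k + N) = v k" for k by (induction k) (simp_all add: v)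
  then show ?R using N v(1) vB v(2) letter by (intro exI[of _ N] conjI N exI[of _ v]) auto
next
  assume ?R
  then obtain N v where N: "0 < N" and v: "v 0 = x" "\<And>k. v k \<in> B" "\<And>k. \<exists>j\<in>I. v (Suc k) = E j (v k)"
    "\<And>k. v (k + N) = v k" by blast
  obtain f where f: "\<And>k. f k \<in> I" "\<And>k. v (Suc k) = E (f k) (v k)" using v(3) by metis
  have "fold E (map f [0..<k]) (v 0) = v k" for k by (induction k) (auto simp: f)
  from this[of N] have "fold E (map f [0..<N]) x = x" using v(1) v(4)[of 0] by simp
  moreover have "x \<in> B" using v by metis
  ultimately show ?L using N f(1) unfolding word_fixpoints_def
    by (auto intro!: exI[of _ "map f [0..<N]"])
qed

text \<open>Let \<open>x\<close> be fixed by the word \<open>js\<close>. A fixed point \<open>y\<close> of the word that applies a letter \<open>i\<close> first and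
then many copies of \<open>js\<close> is close to \<open>x\<close>, since the copies of \<open>js\<close> contract towards \<open>x\<close>. It differs
from \<open>x\<close> if \<open>x\<close> is not a fixed point of \<open>i\<close>, and at most one letter fixes \<open>x\<close>.\<close>
lemma word_fixpoints_islimpt:
  assumes "x \<in> P"
  shows "x islimpt P"
proof -
  obtain js where x: "x \<in> B" and js: "js \<noteq> []" "set js \<subseteq> I" "fold E js x = x"
    using assms by (auto simp: word_fixpoints_def)
  have rep: "fold E (concat (replicate k js)) x = x" for k by (induction k) (auto simp: js)
  have rep_set: "set (concat (replicate k js)) \<subseteq> I" for k using js by auto
  have rep_len: "k \<le> length (concat (replicate k js))" for k
  proof (induction k)
    case (Suc k)
    have "1 \<le> length js" using js(1) by (cases js) auto
    then show ?case using Suc by simp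
  qed simp
  obtain i where i: "i \<in> I" "E i x \<noteq> x"
  proof -
    obtain i k where ik: "i \<in> I" "k \<in> I" "i \<noteq> k"
      using I by (metis card_le_Suc0_iff_eq not_less_eq_eq numeral_2_eq_2)
    have "E i x \<noteq> x \<or> E k x \<noteq> x" using sep[of i k x x] ik x by metis
    then show ?thesis using that ik by blast
  qed
  obtain D where D: "\<And>u v. u \<in> B \<Longrightarrow> v \<in> B \<Longrightarrow> dist u v \<le> D"
    using B(1) compact_imp_bounded bounded_two_points by metis
  show ?thesis
    unfolding islimpt_approachable
  proof (intro allI impI)
    fix e :: real assume "0 < e"
    have "0 \<le> D" using D[OF x x] by simp
    obtain k where k: "\<kappa> ^ k < e / (D + 1)"
      using real_arch_pow_inv[of "e / (D + 1)" \<kappa>] \<open>0 < e\<close> \<open>0 \<le> D\<close> \<kappa> by auto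
    define ws where "ws = concat (replicate k js)"
    have ws: "set ws \<subseteq> I" "fold E ws x = x" "k \<le> length ws"
      using rep rep_set rep_len by (auto simp: ws_def)
    have iws: "set (i # ws) \<subseteq> I" "i # ws \<noteq> []" using i ws by auto
    obtain y where y: "y \<in> B" "fold E (i # ws) y = y"
      using word_fixpoint_exists[OF iws] by blast
    have yP: "y \<in> P" using y iws unfolding word_fixpoints_def by blast
    have Ey: "E i y \<in> B" using maps i y by blast
    have "dist y x = dist (fold E ws (E i y)) (fold E ws x)" using y ws by simp
    also have "\<dots> \<le> \<kappa> ^ length ws * dist (E i y) x" using word_contr ws Ey x by blast
    also have "\<dots> \<le> \<kappa> ^ k * D"
      using \<kappa> ws D[OF Ey x] by (intro mult_mono power_decreasing) auto
    also have "\<dots> \<le> \<kappa> ^ k * (D + 1)" using \<kappa> by (intro mult_left_mono) auto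
    also have "\<dots> < e" using k \<open>0 \<le> D\<close> by (simp add: field_simps)
    finally have "dist y x < e" .
    moreover have "y \<noteq> x"
    proof
      assume "y = x"
      then have "fold E ws (E i x) = fold E ws x" using y ws by simp
      then show False using word_inj[OF ws(1)] maps i x by blast
    qed
    ultimately show "\<exists>x'\<in>P. x' \<noteq> x \<and> dist x' x < e" using yP by blast
  qed
qed

lemma word_fixpoints_decompose: "P \<subseteq> (\<Union>j\<in>I. E j ` P)"
proof
  fix x assume "x \<in> P"
  then obtain js where x: "x \<in> B" and js: "js \<noteq> []" "set js \<subseteq> I" "fold E js x = x"
    by (auto simp: word_fixpoints_def)
  obtain ks j where ks: "js = ks @ [j]" using js(1) by (metis rev_exhaust)
  define y where "y = fold E ks x"
  have x_eq: "E j y = x" using js ks by (simp add: y_def)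
  have "y \<in> B" using word_maps js ks x by (auto simp: y_def)
  moreover have "fold E (j # ks) y = y" using x_eq by (simp add: y_def)
  ultimately have "y \<in> P" using js ks by (auto simp: word_fixpoints_def intro!: exI[of _ "j # ks"])
  then show "x \<in> (\<Union>j\<in>I. E j ` P)" using x_eq js ks by auto
qed

lemma contr_continuous: "j \<in> I \<Longrightarrow> continuous_on B (E j)"
  using contr \<kappa> by (intro lipschitz_on_continuous_on[of \<kappa>] lipschitz_onI) auto

lemma limit_set_decompose: "closure P \<subseteq> (\<Union>j\<in>I. E j ` closure P)"
proof (rule closure_minimal)
  show "P \<subseteq> (\<Union>j\<in>I. E j ` closure P)"
    using word_fixpoints_decompose closure_subset[of P] by blast
  have "compact (E j ` closure P)" if "j \<in> I" for j
    using contr_continuous[OF that] limit_set_subset limit_set_compact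
    by (meson compact_continuous_image continuous_on_subset)
  then show "closed (\<Union>j\<in>I. E j ` closure P)"
    using I by (intro closed_UN) (auto intro: compact_imp_closed)
qed

text \<open>The limit set is covered by the disjoint compact images of the finitely many maps, so a connected
subset lies in one of them, and the inverse of an injective continuous map of a compact
set transports it back.\<close>
lemma connected_pullback:
  assumes "connected X" "X \<subseteq> closure P" "X \<noteq> {}"
  obtains j Y where "j \<in> I" "connected Y" "Y \<subseteq> closure P" "X = E j ` Y"
proof -
  define L where "L = closure P"
  have Lcpt: "compact L" and LB: "L \<subseteq> B" using limit_set_compact limit_set_subset by (auto simp: L_def)
  have cont: "continuous_on L (E j)" if "j \<in> I" for j
    using contr_continuous[OF that] LB continuous_on_subset by blast
  have cptE: "compact (E j ` L)" if "j \<in> I" for j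
    using cont[OF that] Lcpt by (rule compact_continuous_image)
  obtain x where x: "x \<in> X" using assms by blast
  have cover: "X \<subseteq> (\<Union>j\<in>I. E j ` L)" using assms limit_set_decompose by (auto simp: L_def)
  then obtain j where j: "j \<in> I" "x \<in> E j ` L" using x by blast
  define R where "R = (\<Union>k\<in>I - {j}. E k ` L)"
  have closed: "closed (E j ` L)" "closed R"
    using cptE j I unfolding R_def by (auto intro!: closed_UN intro: compact_imp_closed)
  have disj: "E j ` L \<inter> R = {}"
  proof (rule equals0I)
    fix v assume "v \<in> E j ` L \<inter> R"
    then obtain k u w where "k \<in> I" "k \<noteq> j" "u \<in> L" "w \<in> L" "E j u = E k w"
      by (auto simp: R_def)
    then show False using sep[of j k u w] j(1) LB by blast
  qed
  have "X \<subseteq> E j ` L \<union> R" using cover by (auto simp: R_def)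
  then have "R \<inter> X = {}"
    using connected_closedD[OF assms(1), of "E j ` L" R] closed disj x j by blast
  then have XE: "X \<subseteq> E j ` L" using \<open>X \<subseteq> E j ` L \<union> R\<close> by blast
  have inj: "inj_on (E j) L" using sep[OF j(1) j(1)] LB by (meson inj_onI subsetD)
  obtain g where g: "homeomorphism L (E j ` L) (E j) g"
    using homeomorphism_compact[OF Lcpt cont[OF j(1)] refl inj] by blast
  have "connected (g ` X)"
    using g XE assms(1) by (meson connected_continuous_image continuous_on_subset homeomorphism_def)
  moreover have "g ` X \<subseteq> L" using g XE by (auto simp: homeomorphism_def)
  moreover have "E j ` g ` X = X" using g XE by (force simp: homeomorphism_def)
  ultimately show ?thesis using that[of j "g ` X"] j by (auto simp: L_def)
qed

text \<open>A connected subset has at most \<open>\<kappa>\<close> times the diameter of its pullback, which is again connected. After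
\<open>k\<close> pullbacks inside the bounded limit set its diameter is seen to be at most a constant times \<open>\<kappa>\<^sup>k\<close>.\<close>
lemma limit_set_connected_subset_trivial:
  assumes "connected X" "X \<subseteq> closure P" "x \<in> X" "y \<in> X"
  shows "x = y"
proof -
  obtain D where D: "\<And>u v. u \<in> B \<Longrightarrow> v \<in> B \<Longrightarrow> dist u v \<le> D"
    using B(1) compact_imp_bounded bounded_two_points by metis
  have gen: "dist x y \<le> \<kappa> ^ k * D" if "connected X" "X \<subseteq> closure P" "x \<in> X" "y \<in> X" for k X x y
    using that
  proof (induction k arbitrary: X x y)
    case 0
    then show ?case using D[of x y] limit_set_subset by auto
  next
    case (Suc k)
    obtain j Y where Y: "j \<in> I" "connected Y" "Y \<subseteq> closure P" "X = E j ` Y"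
      using connected_pullback[of X] Suc.prems by blast
    then obtain u v where uv: "u \<in> Y" "v \<in> Y" "x = E j u" "y = E j v"
      using Suc.prems(3,4) by blast
    have "dist x y \<le> \<kappa> * dist u v"
      using contr[OF Y(1), of u v] Y(3) uv limit_set_subset by auto
    also have "\<dots> \<le> \<kappa> * (\<kappa> ^ k * D)" using Suc.IH Y uv \<kappa> by (intro mult_left_mono) auto
    finally show ?case by simp
  qed
  have bd: "dist x y \<le> \<kappa> ^ k * D" for k by (rule gen[OF assms])
  have "(\<lambda>k. \<kappa> ^ k * D) \<longlonglongrightarrow> 0 * D" using \<kappa> by (intro tendsto_intros LIMSEQ_realpow_zero) auto
  then have "dist x y \<le> 0" using bd LIMSEQ_le_const[of "\<lambda>k. \<kappa> ^ k * D" "0 * D" "dist x y"] by auto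
  then show ?thesis by simp
qed

lemma limit_set_nonempty: "P \<noteq> {}"
proof -
  have "I \<noteq> {}" using I by auto
  then obtain i where "i \<in> I" by blast
  then have i: "set [i] \<subseteq> I" "[i] \<noteq> []" by auto
  obtain x where "x \<in> B" "fold E [i] x = x" by (rule word_fixpoint_exists[OF i])
  then have "x \<in> P" using i unfolding word_fixpoints_def by blast
  then show ?thesis by blast
qed

end

text \<open>On a compact set an injective continuous map is a homeomorphism, so each \<open>f i\<close> carries the limit points
and the triviality of connected subsets over to its image. A connected subset of the union meets only one
of the finitely many disjoint closed images.\<close>
lemma cantor_set_disjoint_images:
  fixes f :: "'i \<Rightarrow> 'a::metric_space \<Rightarrow> 'b::heine_borel"
  assumes S: "finite S" "S \<noteq> {}"
    and A: "compact (closure A)" "A \<noteq> {}" "\<And>x. x \<in> A \<Longrightarrow> x islimpt A"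
    and triv: "\<And>X x y. \<lbrakk>connected X; X \<subseteq> closure A; x \<in> X; y \<in> X\<rbrakk> \<Longrightarrow> x = y"
    and cont: "\<And>i. i \<in> S \<Longrightarrow> continuous_on (closure A) (f i)"
    and inj: "\<And>i. i \<in> S \<Longrightarrow> inj_on (f i) (closure A)"
    and disj: "\<And>i j. \<lbrakk>i \<in> S; j \<in> S; i \<noteq> j\<rbrakk> \<Longrightarrow> f i ` closure A \<inter> f j ` closure A = {}"
  shows "cantor_set (closure (\<Union>i\<in>S. f i ` A))"
proof -
  define L where "L = closure A"
  define J where "J = (\<Union>i\<in>S. f i ` L)"
  have cpt: "compact (f i ` L)" if "i \<in> S" for i
    using cont[OF that] A(1) unfolding L_def by (rule compact_continuous_image)
  have J: "closure (\<Union>i\<in>S. f i ` A) = J"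
  proof
    show "closure (\<Union>i\<in>S. f i ` A) \<subseteq> J"
    proof (rule closure_minimal)
      show "closed J" unfolding J_def using S cpt by (intro closed_UN) (auto intro: compact_imp_closed)
      show "(\<Union>i\<in>S. f i ` A) \<subseteq> J" using closure_subset[of A] by (auto simp: J_def L_def)
    qed
    have "f i ` L \<subseteq> closure (f i ` A)" if "i \<in> S" for i
      unfolding L_def using cont[OF that] closure_subset[of "f i ` A"]
      by (intro image_closure_subset) auto
    then show "J \<subseteq> closure (\<Union>i\<in>S. f i ` A)"
      unfolding J_def by (smt (verit, best) SUP_least SUP_upper closure_mono order_trans)
  qed
  have "compact J" unfolding J_def using S cpt by (intro compact_UN) auto
  moreover have "J \<noteq> {}" using S A closure_subset[of A] by (auto simp: J_def L_def)
  moreover have "y islimpt J" if "y \<in> J" for y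
  proof -
    obtain i x where i: "i \<in> S" and x: "x \<in> L" "y = f i x" using \<open>y \<in> J\<close> by (auto simp: J_def)
    have "x islimpt L"
    proof (cases "x \<in> A")
      case True
      then show ?thesis using A(3) closure_subset[of A] islimpt_subset by (metis L_def)
    next
      case False
      then have "x islimpt A" using x by (simp add: L_def closure_def)
      then show ?thesis using closure_subset[of A] islimpt_subset by (metis L_def)
    qed
    then obtain s where s: "\<And>n. s n \<in> L - {x}" "s \<longlonglongrightarrow> x"
      unfolding islimpt_sequential by blast
    have "(\<lambda>n. f i (s n)) \<longlonglongrightarrow> f i x"
      using continuous_on_tendsto_compose[OF cont[OF i] s(2)] x s(1) by (auto simp: L_def)
    moreover have "f i (s n) \<in> J - {f i x}" for n
      using s(1)[of n] inj[OF i] x i by (auto simp: J_def L_def inj_on_def)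
    ultimately show ?thesis unfolding x islimpt_sequential
      by (intro exI[of _ "\<lambda>n. f i (s n)"]) blast
  qed
  moreover have "connected_component_set J y = {y}" if "y \<in> J" for y
  proof -
    obtain i where i: "i \<in> S" "y \<in> f i ` L" using \<open>y \<in> J\<close> by (auto simp: J_def)
    have "v = y" if v: "v \<in> connected_component_set J y" for v
    proof -
      define C where "C = connected_component_set J y"
      have C: "connected C" "C \<subseteq> J" "y \<in> C" "v \<in> C"
        using connected_connected_component connected_component_subset v \<open>y \<in> J\<close>
        by (auto simp: C_def)
      define R where "R = (\<Union>k\<in>S - {i}. f k ` L)"
      have "closed (f i ` L)" "closed R"
        using cpt i S unfolding R_def by (auto intro!: closed_UN compact_imp_closed)
      moreover have "f i ` L \<inter> R = {}" using disj i unfolding R_def L_def by blast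
      moreover have CR: "C \<subseteq> f i ` L \<union> R" using C by (auto simp: J_def R_def)
      ultimately have "R \<inter> C = {}"
        using connected_closedD[OF C(1), of "f i ` L" R] C i by blast
      then have CE: "C \<subseteq> f i ` L" using CR by blast
      obtain g where g: "homeomorphism L (f i ` L) (f i) g"
        using homeomorphism_compact[of L "f i"] A(1) cont inj i by (auto simp: L_def)
      have "connected (g ` C)"
        using g CE C by (meson connected_continuous_image continuous_on_subset homeomorphism_def)
      moreover have "g ` C \<subseteq> L" using g CE by (auto simp: homeomorphism_def)
      ultimately have "g v = g y" using triv[of "g ` C" "g v" "g y"] C by (auto simp: L_def)
      then show ?thesis using g CE C by (metis homeomorphism_def subsetD)
    qed
    then show ?thesis using \<open>y \<in> J\<close> by auto
  qed
  ultimately show ?thesis unfolding J cantor_set_def by simp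
qed

section \<open>Multipliers, and attracting cycles attract the critical point\<close>

text \<open>By logarithmic differentiation of \<open>(\<phi> - c)\<^sup>q = u\<^sup>p\<close>, every branch \<open>\<phi>\<close> has derivative
\<open>(p/q) (\<phi> u - c) / u\<close> at \<open>u \<noteq> 0\<close>. So the multiplier along an orbit depends only on the points of the orbit.\<close>
definition multiplier :: "nat \<Rightarrow> nat \<Rightarrow> complex \<Rightarrow> (nat \<Rightarrow> complex) \<Rightarrow> nat \<Rightarrow> complex" where
  "multiplier p q c w m = (\<Prod>i<m. of_nat p / of_nat q * (w (Suc i) - c) / w i)"

lemma multiplier_add:
  "multiplier p q c w (j + k) = multiplier p q c w j * multiplier p q c (\<lambda>i. w (j + i)) k"
  by (induction k) (simp_all add: multiplier_def)

lemma log_derivative_relation: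
  fixes A X :: complex
  assumes "of_nat q * A ^ (q - 1) * D = of_nat p * X ^ (p - 1) * E" "A ^ q = X ^ p"
    and "X \<noteq> 0" "1 \<le> q" "1 \<le> p"
  shows "of_nat q * D * X = of_nat p * A * E"
proof -
  have "of_nat q * (A ^ (q - 1) * A) * D * X = (of_nat q * A ^ (q - 1) * D) * (A * X)"
    by (simp only: mult_ac)
  also have "\<dots> = of_nat p * (X ^ (p - 1) * X) * A * E"
    unfolding assms(1) by (simp only: mult_ac)
  finally have eq: "of_nat q * (A ^ (q - 1) * A) * D * X = of_nat p * (X ^ (p - 1) * X) * A * E" .
  have powers: "A ^ (q - 1) * A = X ^ p" "X ^ (p - 1) * X = X ^ p"
    using power_minus_mult[of q A] power_minus_mult[of p X] assms(2,4,5) by auto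
  have "X ^ p * (of_nat q * D * X) = X ^ p * (of_nat p * A * E)"
    using eq[unfolded powers] by (simp only: mult_ac)
  then show ?thesis using assms(3) by simp
qed

lemma branch_deriv:
  assumes "1 \<le> q" "1 \<le> p" "is_branch p q c U \<phi>" "x \<in> U" "x \<noteq> 0"
  shows "deriv \<phi> x = of_nat p / of_nat q * (\<phi> x - c) / x"
proof -
  have U: "open U" "\<phi> holomorphic_on U" and eq: "\<And>u. u \<in> U \<Longrightarrow> (\<phi> u - c) ^ q = u ^ p"
    using assms(3) by (auto simp: is_branch_def)
  have d: "(\<phi> has_field_derivative deriv \<phi> x) (at x)"
    by (rule holomorphic_derivI[OF U(2,1) assms(4)])
  have "((\<lambda>u. (\<phi> u - c) ^ q) has_field_derivative of_nat q * (\<phi> x - c) ^ (q - 1) * deriv \<phi> x) (at x)"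
    using DERIV_power[OF DERIV_diff[OF d DERIV_const[of c]], of q] by (simp add: mult_ac)
  then have "((\<lambda>u. u ^ p) has_field_derivative of_nat q * (\<phi> x - c) ^ (q - 1) * deriv \<phi> x) (at x)"
    using eq by (rule has_field_derivative_transform_within_open[OF _ U(1) assms(4)])
  moreover have "((\<lambda>u. u ^ p) has_field_derivative of_nat p * x ^ (p - 1)) (at x)"
    using DERIV_power[OF DERIV_ident, of p x UNIV] by simp
  ultimately have "of_nat q * (\<phi> x - c) ^ (q - 1) * deriv \<phi> x = of_nat p * x ^ (p - 1)"
    by (rule DERIV_unique)
  then have "of_nat q * deriv \<phi> x * x = of_nat p * (\<phi> x - c) * 1"
    by (intro log_derivative_relation[OF _ eq[OF assms(4)] assms(5,1,2)]) (simp only: mult_1_right)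
  then show ?thesis using assms by (simp add: field_simps)
qed

lemma branch_at:
  assumes "1 \<le> q" "1 \<le> p" "w \<in> corr p q c x" "x \<noteq> 0"
  shows "is_branch p q c (ball x (norm x)) (\<lambda>u. c + (w - c) * frac_power p q (u / x))"
  unfolding is_branch_def
proof (intro conjI ballI)
  have "norm (u / x - 1) < 1" if "u \<in> ball x (norm x)" for u
  proof -
    have "u / x - 1 = (u - x) / x" using assms by (simp add: field_simps)
    then show ?thesis using that assms by (simp add: norm_divide dist_norm norm_minus_commute)
  qed
  then have "(frac_power p q \<circ> (\<lambda>u. u / x)) field_differentiable at u" if "u \<in> ball x (norm x)" for u
    using that assms(4) frac_power_deriv[of "u / x" p q]
    by (intro field_differentiable_compose)
      (auto intro!: derivative_intros simp del: One_nat_def simp: field_differentiable_def)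
  then have "(\<lambda>u. frac_power p q (u / x)) holomorphic_on ball x (norm x)"
    by (auto simp: holomorphic_on_def comp_def intro: field_differentiable_at_within)
  then show "(\<lambda>u. c + (w - c) * frac_power p q (u / x)) holomorphic_on ball x (norm x)"
    by (intro holomorphic_intros)
  fix u
  show "(c + (w - c) * frac_power p q (u / x) - c) ^ q = u ^ p"
    using assms frac_power_power[OF assms(1,2), of "u / x"]
    by (simp add: power_mult_distrib corr_def power_divide)
qed simp

lemma attracting_cycle_iff:
  assumes "1 \<le> q" "1 \<le> p"
  shows "attracting_cycle p q c w \<longleftrightarrow> (\<exists>m. cycle_of_period p q c m w \<and>
    ((\<exists>i. w i = 0) \<or> (\<forall>i. w i \<noteq> 0) \<and> norm (multiplier p q c w m) < 1))"
proof -
  have crit: "(\<exists>\<phi> U. (\<forall>i<m. w i \<in> U i \<and> is_branch p q c (U i) (\<phi> i) \<and> \<phi> i (w i) = w (Suc i)) \<and>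
                 norm (\<Prod>i<m. deriv (\<phi> i) (w i)) < 1) \<longleftrightarrow> norm (multiplier p q c w m) < 1"
    (is "?L \<longleftrightarrow> ?R") if cyc: "cycle_of_period p q c m w" and nz: "\<forall>i. w i \<noteq> 0" for m
  proof -
    have prod: "(\<Prod>i<m. deriv (\<phi> i) (w i)) = multiplier p q c w m"
      if \<phi>: "\<And>i. i < m \<Longrightarrow> w i \<in> U i \<and> is_branch p q c (U i) (\<phi> i) \<and> \<phi> i (w i) = w (Suc i)" for \<phi> U
    proof -
      have "deriv (\<phi> i) (w i) = of_nat p / of_nat q * (w (Suc i) - c) / w i" if "i < m" for i
      proof -
        have b: "w i \<in> U i" "is_branch p q c (U i) (\<phi> i)" "\<phi> i (w i) = w (Suc i)" "w i \<noteq> 0"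
          using \<phi>[OF that] nz by auto
        show ?thesis using branch_deriv[OF assms b(2,1,4)] unfolding b(3) .
      qed
      then show ?thesis unfolding multiplier_def by simp
    qed
    show ?thesis
    proof
      assume ?L
      then obtain \<phi> U where "\<And>i. i < m \<Longrightarrow> w i \<in> U i \<and> is_branch p q c (U i) (\<phi> i) \<and> \<phi> i (w i) = w (Suc i)"
        and "norm (\<Prod>i<m. deriv (\<phi> i) (w i)) < 1" by blast
      then show ?R using prod[of U \<phi>] by metis
    next
      assume ?R
      define U where "U i = ball (w i) (norm (w i))" for i
      define \<phi> where "\<phi> i u = c + (w (Suc i) - c) * frac_power p q (u / w i)" for i u
      have branch: "w i \<in> U i \<and> is_branch p q c (U i) (\<phi> i) \<and> \<phi> i (w i) = w (Suc i)" for i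
      proof (intro conjI)
        show "is_branch p q c (U i) (\<phi> i)" unfolding U_def \<phi>_def
          using cyc nz by (intro branch_at[OF assms]) (auto simp: cycle_of_period_def forward_orbit_def)
      qed (use nz in \<open>auto simp: U_def \<phi>_def\<close>)
      have "(\<Prod>i<m. deriv (\<phi> i) (w i)) = multiplier p q c w m" by (rule prod[OF branch])
      then have n1: "norm (\<Prod>i<m. deriv (\<phi> i) (w i)) < 1" using \<open>?R\<close> by (simp only:)
      show ?L by (intro exI[of _ \<phi>] exI[of _ U] conjI[OF _ n1]) (use branch in simp)
    qed
  qed
  show ?thesis unfolding attracting_cycle_def by (intro iff_exI conj_cong disj_cong refl crit)
qed

text \<open>The first return along the cycle is holomorphic with derivative of modulus less than \<open>1\<close> at \<open>w 0\<close>.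
Hence a small disc around \<open>w 0\<close> is mapped into itself, and the orbits that follow the branches of the
cycle from this disc are bounded.\<close>
lemma attracting_cycle_basin:
  assumes "1 \<le> q" "1 \<le> p" "cycle_of_period p q c m w" "\<forall>i. w i \<noteq> 0"
    and "norm (multiplier p q c w m) < 1"
  shows "\<exists>r>0. \<forall>x\<in>ball (w 0) r. \<exists>u. bounded_orbit p q c u \<and> u 0 = x"
proof -
  have m: "0 < m" and per: "w m = w 0" and orb: "\<And>i. w (Suc i) \<in> corr p q c (w i)"
    using assms(3) unfolding cycle_of_period_def forward_orbit_def by (auto, metis add_0)
  define \<phi> where "\<phi> = (\<lambda>i u. c + (w (Suc i) - c) * frac_power p q (u / w i))"
  define F where "F = rec_nat (\<lambda>x. x) (\<lambda>i Fi x. \<phi> i (Fi x))"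
  have F0: "F 0 x = x" and FS: "F (Suc i) x = \<phi> i (F i x)" for i x by (simp_all add: F_def)
  have branch: "is_branch p q c (ball (w i) (norm (w i))) (\<phi> i)" for i
    unfolding \<phi>_def using assms orb by (intro branch_at) auto
  have \<phi>w: "\<phi> i (w i) = w (Suc i)" for i using assms(4) by (simp add: \<phi>_def)
  have F: "F i (w 0) = w i \<and> (F i has_field_derivative multiplier p q c w i) (at (w 0))" for i
  proof (induction i)
    case 0
    then show ?case by (simp add: F_def multiplier_def)
  next
    case (Suc i)
    have "(\<phi> i has_field_derivative deriv (\<phi> i) (w i)) (at (w i))"
      using branch[of i] assms(4) unfolding is_branch_def
      by (intro holomorphic_derivI[of _ "ball (w i) (norm (w i))"]) auto
    moreover have "deriv (\<phi> i) (w i) = of_nat p / of_nat q * (w (Suc i) - c) / w i"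
      using branch_deriv[OF assms(1,2) branch, of "w i" i] assms(4) \<phi>w by auto
    ultimately have "(\<phi> i \<circ> F i has_field_derivative
        (of_nat p / of_nat q * (w (Suc i) - c) / w i) * multiplier p q c w i) (at (w 0))"
      using Suc by (intro DERIV_chain) auto
    moreover have comp: "\<phi> i \<circ> F i = F (Suc i)" by (auto simp: F_def)
    ultimately have "(F (Suc i) has_field_derivative
        (of_nat p / of_nat q * (w (Suc i) - c) / w i) * multiplier p q c w i) (at (w 0))"
      by (simp only: comp)
    then have "(F (Suc i) has_field_derivative multiplier p q c w (Suc i)) (at (w 0))"
      by (simp add: multiplier_def mult.commute)
    then show ?case using Suc \<phi>w[of i] FS[of i "w 0"] by metis
  qed
  have "\<forall>\<^sub>F x in at (w 0). norm ((F m x - F m (w 0)) / (x - w 0)) < 1"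
  proof -
    have "((\<lambda>x. norm ((F m x - F m (w 0)) / (x - w 0))) \<longlongrightarrow> norm (multiplier p q c w m)) (at (w 0))"
      using F[of m] unfolding has_field_derivative_iff by (intro tendsto_norm) blast
    then show ?thesis using assms(5) by (rule order_tendstoD)
  qed
  then obtain r1 where r1: "r1 > 0" and
    r1': "\<And>x. x \<noteq> w 0 \<Longrightarrow> dist x (w 0) < r1 \<Longrightarrow> norm ((F m x - F m (w 0)) / (x - w 0)) < 1"
    unfolding eventually_at by auto
  have contr: "dist (F m x) (w 0) \<le> dist x (w 0)" if "dist x (w 0) < r1" for x
  proof (cases "x = w 0")
    case False
    then have "norm (F m x - w 0) < norm (x - w 0)"
      using r1'[OF False that] F[of m] per by (simp add: norm_divide divide_less_eq)
    then show ?thesis by (simp add: dist_norm)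
  qed (use F[of m] per in simp)
  have "\<forall>\<^sub>F x in at (w 0). \<forall>i\<in>{..<m}. dist (F i x) (w i) < 1"
  proof (rule eventually_ball_finite)
    show "\<forall>i\<in>{..<m}. \<forall>\<^sub>F x in at (w 0). dist (F i x) (w i) < 1"
    proof
      fix i
      have "isCont (F i) (w 0)" using F DERIV_isCont by blast
      then have "(F i \<longlongrightarrow> w i) (at (w 0))" using F[of i] by (simp add: isCont_def)
      then show "\<forall>\<^sub>F x in at (w 0). dist (F i x) (w i) < 1" by (rule tendstoD) simp
    qed
  qed simp
  then obtain r2 where r2: "r2 > 0" and
    r2': "\<And>x i. x \<noteq> w 0 \<Longrightarrow> dist x (w 0) < r2 \<Longrightarrow> i < m \<Longrightarrow> dist (F i x) (w i) < 1"
    unfolding eventually_at by auto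
  define r where "r = min r1 r2"
  have close: "dist (F i x) (w i) < 1" if "dist x (w 0) < r" "i < m" for x i
    using r2'[of x i] that F[of i] by (cases "x = w 0") (auto simp: r_def)
  have "\<exists>u. bounded_orbit p q c u \<and> u 0 = x" if x: "x \<in> ball (w 0) r" for x
  proof -
    have iter: "dist ((F m ^^ k) x) (w 0) < r" for k
    proof (induction k)
      case 0
      then show ?case using x by (simp add: dist_commute)
    next
      case (Suc k)
      then show ?case using contr[of "(F m ^^ k) x"] by (auto simp: r_def)
    qed
    define u where "u i = F (i mod m) ((F m ^^ (i div m)) x)" for i
    have "u (Suc i) \<in> corr p q c (u i)" for i
    proof -
      define y where "y = (F m ^^ (i div m)) x"
      have step: "F (Suc (i mod m)) y \<in> corr p q c (F (i mod m) y)"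
      proof -
        have "(\<phi> j v - c) ^ q = v ^ p" for j v
          using assms(4) frac_power_power[OF assms(1,2), of "v / w j"] orb[of j]
          by (simp add: \<phi>_def power_mult_distrib corr_def power_divide)
        then show ?thesis by (simp add: FS corr_def)
      qed
      have "u (Suc i) = F (Suc (i mod m)) y"
      proof (cases "Suc (i mod m) = m")
        case True
        then have "Suc i mod m = 0" "Suc i div m = Suc (i div m)"
          by (auto simp: mod_Suc div_Suc)
        then show ?thesis using True by (simp add: u_def y_def F0)
      next
        case False
        then have "Suc i mod m = Suc (i mod m)" "Suc i div m = i div m"
          by (auto simp: mod_Suc div_Suc)
        then show ?thesis by (simp add: u_def y_def)
      qed
      then show ?thesis using step by (simp add: u_def y_def)
    qed
    then have "forward_orbit p q c u" by (simp add: forward_orbit_def)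
    moreover have "bounded (range u)"
    proof -
      have "range u \<subseteq> (\<Union>i<m. ball (w i) 1)"
      proof
        fix y assume "y \<in> range u"
        then obtain i where i: "y = u i" by blast
        have "i mod m < m" using m by simp
        then have "dist (u i) (w (i mod m)) < 1" unfolding u_def using iter close by blast
        then show "y \<in> (\<Union>i<m. ball (w i) 1)" using i \<open>i mod m < m\<close> by (auto simp: dist_commute)
      qed
      moreover have "bounded (\<Union>i<m. ball (w i) 1)" by (intro bounded_UN) auto
      ultimately show ?thesis by (rule bounded_subset[rotated])
    qed
    moreover have "u 0 = x" by (simp add: u_def F0)
    ultimately show ?thesis unfolding bounded_orbit_def by blast
  qed
  moreover have "0 < r" using r1 r2 by (simp add: r_def)
  ultimately show ?thesis by blast
qed

lemma holomorphic_root: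
  fixes f :: "complex \<Rightarrow> complex"
  assumes "f holomorphic_on S" "contractible S" "\<And>x. x \<in> S \<Longrightarrow> f x \<noteq> 0" "1 \<le> p"
    and "x0 \<in> S" "y0 ^ p = f x0 ^ q"
  obtains g where "g holomorphic_on S" "\<And>x. x \<in> S \<Longrightarrow> g x ^ p = f x ^ q" "g x0 = y0"
proof -
  obtain h where h: "h holomorphic_on S" "\<And>x. x \<in> S \<Longrightarrow> f x = exp (h x)"
    using contractible_imp_holomorphic_log[OF assms(1-3)] by blast
  define e where "e x = exp (of_nat q * h x / of_nat p)" for x
  have e: "e x ^ p = f x ^ q" if "x \<in> S" for x
    using assms(4) h(2)[OF that] by (simp add: e_def exp_of_nat_mult[symmetric])
  define g where "g x = y0 / e x0 * e x" for x
  have e0: "e x \<noteq> 0" for x by (simp add: e_def)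
  have "g holomorphic_on S"
    unfolding g_def e_def using assms(4) by (intro holomorphic_intros h) auto
  moreover have "g x ^ p = f x ^ q" if "x \<in> S" for x
    using e[OF that] e[OF assms(5)] e0[of x0] assms(3)[OF assms(5)] assms(6)
    by (simp add: g_def power_mult_distrib power_divide)
  moreover have "g x0 = y0" using e0 by (simp add: g_def)
  ultimately show ?thesis using that by blast
qed

text \<open>If no path from \<open>0\<close> ends in the disc around \<open>w M\<close>, the inverse branch that follows the orbit \<open>w\<close>
backwards for \<open>k\<close> steps is defined on the whole disc. For one further step a \<open>p\<close>-th root of
\<open>(G - c)\<^sup>q\<close> is needed; it exists because \<open>G x = c\<close> would give a path \<open>0 \<rightarrow> c \<rightarrow> \<dots> \<rightarrow> x\<close>.\<close>
lemma inverse_branch_exists: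
  assumes "1 \<le> q" "1 \<le> p" "forward_orbit p q c w" "\<forall>i. w i \<noteq> 0" "0 < r"
    and avoid: "\<And>x k. x \<in> ball (w M) r \<Longrightarrow> (0, x) \<notin> corr_rel p q c ^^ k"
    and "k \<le> M"
  shows "\<exists>G. G holomorphic_on ball (w M) r \<and> G (w M) = w (M - k) \<and>
    (\<forall>x\<in>ball (w M) r. (G x, x) \<in> corr_rel p q c ^^ k) \<and>
    deriv G (w M) * (\<Prod>i=M-k..<M. of_nat p / of_nat q * (w (Suc i) - c) / w i) = 1"
  using \<open>k \<le> M\<close>
proof (induction k)
  case 0
  then show ?case by (intro exI[of _ "\<lambda>x. x"]) auto
next
  case (Suc k)
  define S where "S = ball (w M) r"
  obtain G where G: "G holomorphic_on S" "G (w M) = w (M - k)"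
    and path: "\<And>x. x \<in> S \<Longrightarrow> (G x, x) \<in> corr_rel p q c ^^ k"
    and der: "deriv G (w M) * (\<Prod>i=M-k..<M. of_nat p / of_nat q * (w (Suc i) - c) / w i) = 1"
    using Suc by (auto simp: S_def)
  define i where "i = M - Suc k"
  have i: "M - k = Suc i" "M - Suc k = i" "i < M" using Suc.prems by (auto simp: i_def)
  have x0: "w M \<in> S" using assms(5) by (simp add: S_def)
  have "G x - c \<noteq> 0" if "x \<in> S" for x
  proof
    assume "G x - c = 0"
    then have "(0, G x) \<in> corr_rel p q c" using assms by (simp add: corr_rel_def corr_def zero_power)
    then have "(0, x) \<in> corr_rel p q c ^^ Suc k" using path[OF that] by (rule relpow_Suc_I2)
    then show False using avoid that by (auto simp: S_def simp del: relpow.simps)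
  qed
  moreover have "w i ^ p = (G (w M) - c) ^ q"
    using assms(3) by (simp add: G(2) i forward_orbit_def corr_def)
  moreover have "(\<lambda>x. G x - c) holomorphic_on S" by (intro holomorphic_intros G)
  moreover have "contractible S" unfolding S_def by (intro convex_imp_contractible convex_ball)
  ultimately obtain H where H: "H holomorphic_on S" "\<And>x. x \<in> S \<Longrightarrow> H x ^ p = (G x - c) ^ q" "H (w M) = w i"
    using holomorphic_root[of "\<lambda>x. G x - c" S p "w M" "w i" q] assms(2) x0 by blast
  have "(H x, G x) \<in> corr_rel p q c" if "x \<in> S" for x
    using H(2)[OF that] by (simp add: corr_rel_def corr_def)
  then have pathH: "\<forall>x\<in>S. (H x, x) \<in> corr_rel p q c ^^ Suc k"
    using path relpow_Suc_I2 by metis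
  have dG: "(G has_field_derivative deriv G (w M)) (at (w M))"
    using G x0 by (intro holomorphic_derivI[of _ S]) (auto simp: S_def)
  have dH: "(H has_field_derivative deriv H (w M)) (at (w M))"
    using H x0 by (intro holomorphic_derivI[of _ S]) (auto simp: S_def)
  have "((\<lambda>x. H x ^ p) has_field_derivative of_nat p * w i ^ (p - 1) * deriv H (w M)) (at (w M))"
    using H(3) by (auto intro!: derivative_eq_intros dH)
  then have "((\<lambda>x. (G x - c) ^ q) has_field_derivative of_nat p * w i ^ (p - 1) * deriv H (w M)) (at (w M))"
    by (rule has_field_derivative_transform_within_open[of _ _ _ S]) (use H x0 in \<open>auto simp: S_def\<close>)
  moreover have "((\<lambda>x. (G x - c) ^ q) has_field_derivative
      of_nat q * (w (Suc i) - c) ^ (q - 1) * deriv G (w M)) (at (w M))"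
    using G(2) i by (auto intro!: derivative_eq_intros dG)
  ultimately have rel: "of_nat q * (w (Suc i) - c) ^ (q - 1) * deriv G (w M) = of_nat p * w i ^ (p - 1) * deriv H (w M)"
    by (rule DERIV_unique[symmetric])
  have "(w (Suc i) - c) ^ q = w i ^ p" "w i \<noteq> 0"
    using assms(3,4) by (auto simp: forward_orbit_def corr_def)
  then have "of_nat q * deriv G (w M) * w i = of_nat p * (w (Suc i) - c) * deriv H (w M)"
    by (rule log_derivative_relation[OF rel _ _ assms(1,2)])
  then have eq: "of_nat p * deriv H (w M) * (w (Suc i) - c) = of_nat q * deriv G (w M) * w i"
    by (simp add: mult_ac)
  have step: "deriv H (w M) * (of_nat p / of_nat q * (w (Suc i) - c) / w i) = deriv G (w M)"
    using eq assms by (simp add: field_simps)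
  have "deriv H (w M) * (\<Prod>i=M-Suc k..<M. of_nat p / of_nat q * (w (Suc i) - c) / w i) = 1"
    using der unfolding i prod.atLeast_Suc_lessThan[OF i(3)] mult.assoc[symmetric, of "deriv H (w M)"] step .
  then show ?case using H pathH i by (auto simp: S_def simp del: relpow.simps)
qed

text \<open>The analogue of Fatou's theorem that the basin of an attracting cycle contains a critical point. It is
stated with bounded orbits because a path from \<open>0\<close> into the basin always extends to a bounded orbit,
while the correspondence offers other continuations that escape.\<close>
lemma attracting_cycle_attracts_critical_orbit:
  assumes "1 \<le> q" "q < p" and cyc: "cycle_of_period p q c m w" and nz: "\<forall>i. w i \<noteq> 0"
    and att: "norm (multiplier p q c w m) < 1" and "0 < r"
  shows "\<exists>u k. bounded_orbit p q c u \<and> u 0 = 0 \<and> dist (u k) (w 0) < r"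
proof (rule ccontr)
  assume none: "\<not> ?thesis"
  have p: "1 \<le> p" using assms by simp
  have m: "0 < m" and per: "\<And>i. w (i + m) = w i" and fo: "forward_orbit p q c w"
    using cyc unfolding cycle_of_period_def by auto
  obtain r0 where r0: "r0 > 0" "\<And>x. x \<in> ball (w 0) r0 \<Longrightarrow> \<exists>u. bounded_orbit p q c u \<and> u 0 = x"
    using attracting_cycle_basin[OF assms(1) p cyc nz att] by blast
  define s where "s = min r r0"
  have s: "0 < s" using r0 \<open>0 < r\<close> by (simp add: s_def)
  have avoid: "(0, x) \<notin> corr_rel p q c ^^ k" if xs: "x \<in> ball (w 0) s" for x k
  proof
    assume "(0, x) \<in> corr_rel p q c ^^ k"
    moreover obtain u where "bounded_orbit p q c u" "u 0 = x" using r0(2)[of x] xs by (auto simp: s_def)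
    ultimately obtain v where "bounded_orbit p q c v" "v 0 = 0" "\<And>i. v (k + i) = u i"
      using bounded_orbit_prepend[where x = 0 and w = u and k = k] by blast
    moreover from this have "dist (v k) (w 0) < r"
      using \<open>u 0 = x\<close> xs add_0_right[of k] by (metis dist_commute mem_ball min_less_iff_conj s_def)
    ultimately show False using none by blast
  qed
  define R where "R = max (3 ^ q) (max (norm c) (norm (w 0) + s))"
  define \<mu> where "\<mu> = norm (multiplier p q c w m)"
  \<comment> \<open>After \<open>N\<close> turns of the cycle the inverse branch has derivative of modulus \<open>1 / \<mu>\<^sup>N\<close> at \<open>w 0\<close>, while it is bounded
      by \<open>R\<close> on the disc of radius \<open>s\<close>; Cauchy's inequality on the disc of radius \<open>s / 2\<close> compares the two.\<close>
  have bound: "s \<le> 2 * R * \<mu> ^ N" for N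
  proof -
    define M where "M = m * N"
    have wM: "w M = w 0" using periodic_add_mult[of w m 0 N, OF per] by (simp add: M_def)
    obtain G where G: "G holomorphic_on ball (w 0) s"
      and path: "\<And>x. x \<in> ball (w 0) s \<Longrightarrow> (G x, x) \<in> corr_rel p q c ^^ M"
      and der: "deriv G (w 0) * (\<Prod>i=0..<M. of_nat p / of_nat q * (w (Suc i) - c) / w i) = 1"
      using inverse_branch_exists[OF assms(1) p fo nz s, of M M] avoid wM by auto
    have "(\<Prod>i=0..<M. of_nat p / of_nat q * (w (Suc i) - c) / w i) = multiplier p q c w m ^ N"
    proof -
      have "multiplier p q c w (m * N) = multiplier p q c w m ^ N"
      proof (induction N)
        case 0 then show ?case by (simp add: multiplier_def)
      next
        case (Suc N)
        have "(\<lambda>i. w (m * N + i)) = w"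
          using periodic_add_mult[of w m _ N, OF per] by (simp add: add.commute)
        then show ?case using Suc multiplier_add[of p q c w "m * N" m] by (simp add: add.commute)
      qed
      then show ?thesis by (simp add: multiplier_def M_def atLeast0LessThan)
    qed
    then have one: "norm (deriv G (w 0)) * \<mu> ^ N = 1"
      using der by (metis \<mu>_def norm_mult norm_one norm_power)
    have GR: "norm (G x) \<le> R" if "x \<in> ball (w 0) s" for x
    proof (rule relpow_norm_le[OF assms(1,2) path[OF that]])
      have "norm x \<le> norm (w 0) + s" using that norm_triangle_sub[of x "w 0"]
        by (simp add: dist_norm norm_minus_commute)
      then show "norm x \<le> R" by (simp add: R_def)
    qed (auto simp: R_def)
    have sub: "cball (w 0) (s/2) \<subseteq> ball (w 0) s" using s by (auto simp: dist_norm)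
    have "norm ((deriv ^^ 1) G (w 0)) \<le> fact 1 * R / (s/2) ^ 1"
    proof (rule Cauchy_inequality)
      show "G holomorphic_on ball (w 0) (s/2)" using s by (intro holomorphic_on_subset[OF G]) auto
      show "continuous_on (cball (w 0) (s/2)) G"
        using G sub holomorphic_on_imp_continuous_on continuous_on_subset by blast
      show "norm (G x) \<le> R" if "norm (w 0 - x) = s/2" for x
        using GR[of x] that s by (simp add: dist_norm)
    qed (use s in simp)
    then have "norm (deriv G (w 0)) * s \<le> 2 * R" using s by (simp add: field_simps)
    then have "norm (deriv G (w 0)) * s * \<mu> ^ N \<le> 2 * R * \<mu> ^ N"
      by (intro mult_right_mono) (auto simp: \<mu>_def)
    moreover have "norm (deriv G (w 0)) * s * \<mu> ^ N = s" using one by (simp add: mult_ac)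
    ultimately show ?thesis by simp
  qed
  have "(\<lambda>N. 2 * R * \<mu> ^ N) \<longlonglongrightarrow> 2 * R * 0"
    using att by (intro tendsto_intros LIMSEQ_realpow_zero) (auto simp: \<mu>_def)
  then have "s \<le> 0" using LIMSEQ_le_const[of "\<lambda>N. 2 * R * \<mu> ^ N" "2 * R * 0" s] bound by auto
  then show False using s by simp
qed

section \<open>Orbits near the critical cycle\<close>

text \<open>At an index where the periodic sequence is maximal, the recursion bounds the maximum by itself.\<close>
lemma periodic_contraction_bound:
  fixes f :: "nat \<Rightarrow> real"
  assumes "0 < m" "\<And>k. f (k + m) = f k" "\<And>k. f (Suc k) \<le> \<beta> + f k / 4" "\<And>k. 0 \<le> f k"
  shows "f k \<le> 2 * \<beta>"
proof -
  define M where "M = Max (f ` {..<m})"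
  have le: "f k \<le> M" for k
  proof -
    have "f k = f (k mod m)" using periodic_add_mult[of f m "k mod m" "k div m", OF assms(2)] by simp
    then show ?thesis unfolding M_def using assms(1) by (auto intro!: Max_ge)
  qed
  have "M \<in> f ` {..<m}" unfolding M_def using assms(1) by (intro Max_in) auto
  then obtain i where i: "M = f i" by blast
  have "Suc (i + (m - 1)) = i + m" using assms(1) by simp
  then have "M \<le> \<beta> + f (i + (m - 1)) / 4" using assms(2)[of i] assms(3)[of "i + (m - 1)"] i by simp
  then have "3 * M \<le> 4 * \<beta>" using le[of "i + (m - 1)"] by linarith
  moreover have "0 \<le> M" using i assms(4) by simp
  ultimately show ?thesis using le[of k] by linarith
qed

lemma finite_uniform_radius:
  fixes Q :: "'i \<Rightarrow> real \<Rightarrow> bool"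
  assumes "finite A" "\<And>x. x \<in> A \<Longrightarrow> \<exists>\<delta>>0. Q x \<delta>"
    and mono: "\<And>x \<delta> \<delta>'. \<lbrakk>Q x \<delta>; 0 < \<delta>'; \<delta>' \<le> \<delta>\<rbrakk> \<Longrightarrow> Q x \<delta>'"
  shows "\<exists>\<delta>>0. \<forall>x\<in>A. Q x \<delta>"
  using assms(1,2)
proof (induction A rule: finite_induct)
  case empty
  then show ?case by (intro exI[of _ 1]) auto
next
  case (insert x A)
  obtain \<delta>1 where \<delta>1: "\<delta>1 > 0" "Q x \<delta>1" using insert.prems[of x] by blast
  have "\<exists>\<delta>>0. \<forall>y\<in>A. Q y \<delta>" by (rule insert.IH) (use insert.prems in blast)
  then obtain \<delta>2 where \<delta>2: "\<delta>2 > 0" "\<And>y. y \<in> A \<Longrightarrow> Q y \<delta>2" by blast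
  have "Q y (min \<delta>1 \<delta>2)" if "y \<in> insert x A" for y
  proof (cases "y = x")
    case True
    then show ?thesis using mono[OF \<delta>1(2), of "min \<delta>1 \<delta>2"] \<delta>1(1) \<delta>2(1) by simp
  next
    case False
    then have "Q y \<delta>2" using that \<delta>2 by blast
    then show ?thesis using mono[of y \<delta>2 "min \<delta>1 \<delta>2"] \<delta>1(1) \<delta>2(1) by simp
  qed
  then show ?case using \<delta>1(1) \<delta>2(1) by (intro exI[of _ "min \<delta>1 \<delta>2"]) auto
qed

text \<open>Here \<open>n\<close> is the time of the first return of \<open>0\<close> to itself. That it is a period of \<open>z\<close>, and that
\<open>z 0, \<dots>, z (n - 1)\<close> are distinct, follows from the uniqueness of the bounded orbit.\<close>
locale simple_centre =
  fixes p q :: nat and a :: complex and z :: "nat \<Rightarrow> complex" and n :: nat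
  assumes q: "1 \<le> q" and pq: "q < p"
    and only: "{w. forward_orbit p q a w \<and> w 0 = 0 \<and> bounded (range w)} = {z}"
    and n: "0 < n" "z n = 0" "\<And>i. \<lbrakk>0 < i; i < n\<rbrakk> \<Longrightarrow> z i \<noteq> 0"
begin

lemma p: "1 \<le> p" using q pq by simp

lemma z_orbit: "bounded_orbit p q a z" and z_0: "z 0 = 0"
  using only by (auto simp: bounded_orbit_def)

lemma z_unique: "bounded_orbit p q a w \<Longrightarrow> w 0 = 0 \<Longrightarrow> w = z"
  using only by (auto simp: bounded_orbit_def)

lemma z_Suc: "(z (Suc i) - a) ^ q = z i ^ p"
  using z_orbit by (simp add: bounded_orbit_def forward_orbit_def corr_def)

lemma z_periodic: "z (i + n) = z i"
proof -
  have "(\<lambda>i. z (i + n)) = z" using z_unique[OF bounded_orbit_shift[OF z_orbit]] n by simp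
  then show ?thesis by (rule fun_cong)
qed

lemma z_1: "z 1 = a"
  using z_Suc[of 0] q p by (simp add: z_0 zero_power)

lemma bounded_orbit_unique:
  assumes "bounded_orbit p q a w" "w 0 = z i"
  shows "w k = z (i + k)"
proof -
  have "(z 0, z (0 + i)) \<in> corr_rel p q a ^^ i"
    using z_orbit by (intro relpow_forward_orbit) (simp add: bounded_orbit_def)
  then have "(0, w 0) \<in> corr_rel p q a ^^ i" using assms z_0 by simp
  then obtain u where u: "bounded_orbit p q a u" "u 0 = 0" "\<And>k. u (i + k) = w k"
    using bounded_orbit_prepend[OF _ assms(1)] by blast
  have "u = z" by (rule z_unique[OF u(1,2)])
  then show ?thesis using u(3)[of k] by simp
qed

lemma z_distinct:
  assumes "i < j" "j < n"
  shows "z i \<noteq> z j"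
proof
  assume "z i = z j"
  then have "z (j + (n - j)) = z (i + (n - j))"
    using bounded_orbit_unique[OF bounded_orbit_shift[OF z_orbit, of j], of i "n - j"]
    by (simp add: add.commute)
  moreover have "z (i + (n - j)) \<noteq> 0" using assms by (intro n) auto
  ultimately show False using assms n by simp
qed

text \<open>Otherwise there are parameters \<open>C k\<close> converging to \<open>a\<close> and bounded orbits \<open>W k\<close> with starting points
converging to \<open>z i\<close> that stay away from \<open>z (i + j)\<close> at time \<open>j\<close>. These orbits lie in one common
disc, so a subsequence converges pointwise. The limit is a bounded orbit of \<open>z i\<close> under \<open>f\<^sub>a\<close>, and
\<open>z (i + _)\<close> is the only one.\<close>
lemma shadowing_at:
  assumes "0 < \<epsilon>"
  shows "\<exists>\<delta>>0. \<forall>c w. dist c a < \<delta> \<and> bounded_orbit p q c w \<and> dist (w 0) (z i) \<le> \<delta> \<longrightarrow> dist (w j) (z (i + j)) \<le> \<epsilon>"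
proof (rule ccontr)
  assume neg: "\<not> ?thesis"
  have "\<exists>c w. dist c a < 1 / real (Suc k) \<and> bounded_orbit p q c w \<and> dist (w 0) (z i) \<le> 1 / real (Suc k)
      \<and> \<epsilon> < dist (w j) (z (i + j))" for k
  proof -
    have "0 < 1 / real (Suc k)" by simp
    then show ?thesis using neg by (meson not_le)
  qed
  then obtain C W where CW: "\<And>k. dist (C k) a < 1 / real (Suc k)" "\<And>k. bounded_orbit p q (C k) (W k)"
    "\<And>k. dist (W k 0) (z i) \<le> 1 / real (Suc k)" "\<And>k. \<epsilon> < dist (W k j) (z (i + j))"
    by metis
  define R where "R = max (3 ^ q) (norm a + 1)"
  have "norm (C k) \<le> R" for k
  proof -
    have "dist (C k) a < 1" using less_le_trans[OF CW(1)[of k]] by simp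
    then show ?thesis using norm_triangle_sub[of "C k" a] by (simp add: R_def dist_norm)
  qed
  then have WR: "norm (W k x) \<le> R" for k x
    by (intro bounded_orbit_norm_le[OF q pq CW(2)]) (auto simp: R_def)
  have cnt: "countable (UNIV :: nat set)" by simp
  obtain s where s: "strict_mono s" "\<And>x. x \<in> UNIV \<Longrightarrow> \<exists>l. (\<lambda>k. W (s k) x) \<longlonglongrightarrow> l"
    by (rule function_convergent_subsequence[OF cnt WR]) iprover
  then obtain l where l: "\<And>x. (\<lambda>k. W (s k) x) \<longlonglongrightarrow> l x"
    using choice[of "\<lambda>x l. (\<lambda>k. W (s k) x) \<longlonglongrightarrow> l"] by auto
  have lim0: "(\<lambda>k. 1 / real (Suc (s k))) \<longlonglongrightarrow> 0"
    using LIMSEQ_subseq_LIMSEQ[OF LIMSEQ_inverse_real_of_nat s(1)] by (simp add: o_def inverse_eq_divide)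
  have "(\<lambda>k. dist (C (s k)) a) \<longlonglongrightarrow> 0"
    by (rule tendsto_sandwich[OF _ _ tendsto_const lim0]) (intro always_eventually allI zero_le_dist less_imp_le[OF CW(1)])+
  then have Clim: "(\<lambda>k. C (s k)) \<longlonglongrightarrow> a" by (rule tendsto_dist_iff[THEN iffD2])
  have "(\<lambda>k. dist (W (s k) 0) (z i)) \<longlonglongrightarrow> 0"
    by (rule tendsto_sandwich[OF _ _ tendsto_const lim0]) (intro always_eventually allI zero_le_dist CW(3))+
  then have "(\<lambda>k. W (s k) 0) \<longlonglongrightarrow> z i" by (rule tendsto_dist_iff[THEN iffD2])
  then have l0: "l 0 = z i" using l LIMSEQ_unique by blast
  have "(l (Suc x) - a) ^ q = l x ^ p" for x
  proof -
    have "(\<lambda>k. (W (s k) (Suc x) - C (s k)) ^ q) \<longlonglongrightarrow> (l (Suc x) - a) ^ q"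
      by (intro tendsto_intros l Clim)
    moreover have "(W (s k) (Suc x) - C (s k)) ^ q = W (s k) x ^ p" for k
      using CW(2)[of "s k"] by (simp add: bounded_orbit_def forward_orbit_def corr_def)
    ultimately have "(\<lambda>k. W (s k) x ^ p) \<longlonglongrightarrow> (l (Suc x) - a) ^ q" by simp
    moreover have "(\<lambda>k. W (s k) x ^ p) \<longlonglongrightarrow> l x ^ p" by (intro tendsto_intros l)
    ultimately show ?thesis by (rule LIMSEQ_unique)
  qed
  moreover have "norm (l x) \<le> R" for x
    using LIMSEQ_le_const2[OF tendsto_norm[OF l[of x]], of R] WR by auto
  ultimately have "bounded_orbit p q a l"
    unfolding bounded_orbit_def forward_orbit_def corr_def bounded_iff by auto
  then have "l j = z (i + j)" using l0 by (rule bounded_orbit_unique)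
  then have "(\<lambda>k. dist (W (s k) j) (z (i + j))) \<longlonglongrightarrow> 0" using l[of j] tendsto_dist_iff[THEN iffD1] by metis
  then have "\<epsilon> \<le> 0" using LIMSEQ_le_const[of _ 0 \<epsilon>] CW(4) less_imp_le by blast
  then show False using assms by simp
qed

lemma shadowing:
  assumes "0 < \<epsilon>"
  obtains \<delta> where "0 < \<delta>" "\<And>c w i j. \<lbrakk>dist c a < \<delta>; bounded_orbit p q c w; i < n; j \<le> n; dist (w 0) (z i) \<le> \<delta>\<rbrakk>
    \<Longrightarrow> dist (w j) (z (i + j)) \<le> \<epsilon>"
proof -
  define Q where "Q ij \<delta> \<longleftrightarrow> (\<forall>c w. dist c a < \<delta> \<and> bounded_orbit p q c w \<and> dist (w 0) (z (fst ij)) \<le> \<delta>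
      \<longrightarrow> dist (w (snd ij)) (z (fst ij + snd ij)) \<le> \<epsilon>)" for ij :: "nat \<times> nat" and \<delta> :: real
  have "\<exists>\<delta>>0. \<forall>ij\<in>{..<n} \<times> {..n}. Q ij \<delta>"
  proof (rule finite_uniform_radius)
    show "\<exists>\<delta>>0. Q ij \<delta>" for ij unfolding Q_def by (rule shadowing_at[OF assms])
    show "Q ij \<delta>'" if "Q ij \<delta>" "0 < \<delta>'" "\<delta>' \<le> \<delta>" for ij \<delta> \<delta>'
      unfolding Q_def
    proof (intro allI impI)
      fix c w assume "dist c a < \<delta>' \<and> bounded_orbit p q c w \<and> dist (w 0) (z (fst ij)) \<le> \<delta>'"
      then show "dist (w (snd ij)) (z (fst ij + snd ij)) \<le> \<epsilon>"
        using that(1,3) unfolding Q_def by (meson less_le_trans order_trans)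
    qed
  qed simp
  then obtain \<delta> where "0 < \<delta>" "\<And>i j. i < n \<Longrightarrow> j \<le> n \<Longrightarrow> Q (i, j) \<delta>" by auto
  then show ?thesis using that[of \<delta>] by (simp add: Q_def)
qed

text \<open>The branch of the correspondence at the parameter \<open>c\<close> that passes near \<open>z (Suc i)\<close> at \<open>z i\<close>; at
\<open>c = a\<close> it maps \<open>z i\<close> to \<open>z (Suc i)\<close>. The parameter \<open>c\<close> enters only as a translation, so Lipschitz
constants in \<open>x\<close> are independent of \<open>c\<close>.\<close>
definition near_branch :: "complex \<Rightarrow> nat \<Rightarrow> complex \<Rightarrow> complex" where
  "near_branch c i x = c + (z (Suc i) - a) * frac_power p q (x / z i)"

text \<open>Starting from \<open>v\<close> near \<open>z 1\<close>, these are the next \<open>i\<close> steps along the cycle, so that \<open>follow c i v\<close> is near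
\<open>z (Suc i)\<close>. The step from \<open>z 0 = 0\<close> to \<open>z 1\<close> is left out because it is in general multivalued.\<close>
primrec follow :: "complex \<Rightarrow> nat \<Rightarrow> complex \<Rightarrow> complex" where
  "follow c 0 v = v"
| "follow c (Suc i) v = near_branch c (Suc i) (follow c i v)"

lemma follow_corr:
  assumes "Suc i < n"
  shows "follow c (Suc i) v \<in> corr p q c (follow c i v)"
  using frac_power_power[OF q p, of "follow c i v / z (Suc i)"] n(3)[of "Suc i"] z_Suc[of "Suc i"] assms
  by (simp add: corr_def near_branch_def power_mult_distrib power_divide)

lemma branch_uniqueness:
  obtains \<rho> where "0 < \<rho>" "\<And>i x. \<lbrakk>0 < i; i < n; dist x (z i) \<le> \<rho>\<rbrakk> \<Longrightarrow> \<rho> \<le> norm x"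
    "\<And>i j. \<lbrakk>i < n; j < n; i \<noteq> j\<rbrakk> \<Longrightarrow> cball (z i) \<rho> \<inter> cball (z j) \<rho> = {}"
    "\<And>c i x y. \<lbrakk>0 < i; i < n; dist c a \<le> \<rho>; dist x (z i) \<le> \<rho>; dist y (z (Suc i)) \<le> \<rho>; y \<in> corr p q c x\<rbrakk>
       \<Longrightarrow> y = near_branch c i x"
proof -
  obtain \<epsilon> where \<epsilon>: "0 < \<epsilon>"
    and root: "\<And>y u. \<lbrakk>norm (y - 1) \<le> \<epsilon>; norm (u - 1) \<le> \<epsilon>; y ^ q = u ^ p\<rbrakk> \<Longrightarrow> y = frac_power p q u"
    using frac_power_separation[OF q p] by metis
  have xi: "z (Suc i) - a \<noteq> 0" if "0 < i" "i < n" for i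
    using z_Suc[of i] n(3)[OF that] q p by (auto simp: zero_power)
  define Q1 where "Q1 i \<delta> \<longleftrightarrow> \<delta> \<le> norm (z i) / 2 \<and> \<delta> \<le> \<epsilon> * norm (z i) \<and> 2 * \<delta> \<le> \<epsilon> * norm (z (Suc i) - a)" for i \<delta>
  have "\<exists>\<delta>>0. \<forall>i\<in>{0<..<n}. Q1 i \<delta>"
  proof (rule finite_uniform_radius)
    fix i assume i: "i \<in> {0<..<n}"
    \<comment> \<open>The three bounds keep the disc away from \<open>0\<close> and bring \<open>x / z i\<close> and \<open>(y - c) / (z (Suc i) - a)\<close> within \<open>\<epsilon>\<close>
        of \<open>1\<close>.\<close>
    define m where "m = min (norm (z i) / 2) (min (\<epsilon> * norm (z i)) (\<epsilon> * norm (z (Suc i) - a) / 2))"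
    have "m \<le> norm (z i) / 2" "m \<le> \<epsilon> * norm (z i)" "m \<le> \<epsilon> * norm (z (Suc i) - a) / 2"
      by (simp_all add: m_def)
    moreover have "0 < m" using n(3)[of i] xi[of i] \<epsilon> i by (simp add: m_def)
    ultimately show "\<exists>\<delta>>0. Q1 i \<delta>" unfolding Q1_def by (intro exI[of _ m]) linarith
  qed (auto simp: Q1_def)
  then obtain \<rho>1 where \<rho>1: "0 < \<rho>1" "\<And>i. 0 < i \<Longrightarrow> i < n \<Longrightarrow> Q1 i \<rho>1" by auto
  define Q2 where "Q2 ij \<delta> \<longleftrightarrow> (fst ij \<noteq> snd ij \<longrightarrow> 2 * \<delta> < dist (z (fst ij)) (z (snd ij)))" for ij :: "nat \<times> nat" and \<delta>
  have "\<exists>\<delta>>0. \<forall>ij\<in>{..<n} \<times> {..<n}. Q2 ij \<delta>"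
  proof (rule finite_uniform_radius)
    fix ij assume ij: "ij \<in> {..<n} \<times> {..<n}"
    show "\<exists>\<delta>>0. Q2 ij \<delta>"
    proof (cases "fst ij = snd ij")
      case True
      then show ?thesis by (intro exI[of _ 1]) (auto simp: Q2_def)
    next
      case False
      then have "z (fst ij) \<noteq> z (snd ij)"
        using z_distinct[of "fst ij" "snd ij"] z_distinct[of "snd ij" "fst ij"] ij by (cases "fst ij < snd ij") auto
      then show ?thesis by (intro exI[of _ "dist (z (fst ij)) (z (snd ij)) / 3"]) (auto simp: Q2_def)
    qed
  qed (auto simp: Q2_def)
  then obtain \<rho>2 where \<rho>2: "0 < \<rho>2" "\<And>i j. i < n \<Longrightarrow> j < n \<Longrightarrow> Q2 (i, j) \<rho>2" by auto
  define \<rho> where "\<rho> = min \<rho>1 \<rho>2"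
  have \<rho>: "0 < \<rho>" using \<rho>1 \<rho>2 by (simp add: \<rho>_def)
  have Q1: "Q1 i \<rho>" if "0 < i" "i < n" for i
    using \<rho>1(2)[OF that] by (auto simp: Q1_def \<rho>_def min_def)
  have A: "\<rho> \<le> norm x" if "0 < i" "i < n" "dist x (z i) \<le> \<rho>" for i x
    using Q1[OF that(1,2)] that(3) norm_triangle_sub[of "z i" x]
    by (simp add: Q1_def dist_norm norm_minus_commute)
  have B: "cball (z i) \<rho> \<inter> cball (z j) \<rho> = {}" if "i < n" "j < n" "i \<noteq> j" for i j
  proof (rule equals0I)
    fix x assume "x \<in> cball (z i) \<rho> \<inter> cball (z j) \<rho>"
    then have "dist (z i) (z j) \<le> 2 * \<rho>" using dist_triangle2[of "z i" "z j" x] by simp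
    then show False using \<rho>2(2)[OF that(1,2)] that(3) by (auto simp: Q2_def \<rho>_def)
  qed
  have C: "y = near_branch c i x"
    if i: "0 < i" "i < n" and c: "dist c a \<le> \<rho>" and x: "dist x (z i) \<le> \<rho>" and y: "dist y (z (Suc i)) \<le> \<rho>"
      and cor: "y \<in> corr p q c x" for c i x y
  proof -
    note nz = n(3)[OF i] xi[OF i]
    have "x / z i - 1 = (x - z i) / z i" using nz by (simp add: field_simps)
    then have "norm (x / z i - 1) = dist x (z i) / norm (z i)" by (simp add: norm_divide dist_norm)
    also have "\<dots> \<le> \<epsilon>" using x Q1[OF i] nz by (simp add: Q1_def field_simps)
    finally have u: "norm (x / z i - 1) \<le> \<epsilon>" .
    have "(y - c) / (z (Suc i) - a) - 1 = ((y - z (Suc i)) - (c - a)) / (z (Suc i) - a)"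
      using nz by (simp add: field_simps)
    then have "norm ((y - c) / (z (Suc i) - a) - 1) = norm ((y - z (Suc i)) - (c - a)) / norm (z (Suc i) - a)"
      by (simp add: norm_divide)
    also have "\<dots> \<le> (2 * \<rho>) / norm (z (Suc i) - a)"
      using norm_triangle_ineq4[of "y - z (Suc i)" "c - a"] c y by (intro divide_right_mono) (auto simp: dist_norm)
    also have "\<dots> \<le> \<epsilon>" using Q1[OF i] nz by (simp add: Q1_def field_simps)
    finally have v: "norm ((y - c) / (z (Suc i) - a) - 1) \<le> \<epsilon>" .
    have "((y - c) / (z (Suc i) - a)) ^ q = (x / z i) ^ p"
      using cor z_Suc[of i] by (simp add: power_divide corr_def)
    then have "(y - c) / (z (Suc i) - a) = frac_power p q (x / z i)" by (rule root[OF v u])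
    then have "y - c = (z (Suc i) - a) * frac_power p q (x / z i)" using nz by (simp add: field_simps)
    then show ?thesis by (simp add: near_branch_def algebra_simps)
  qed
  show ?thesis by (rule that[OF \<rho> A B C])
qed

lemma follow_local:
  assumes "i < n" "0 < \<rho>"
  shows "\<exists>\<eta>>0. \<exists>L>0. \<forall>c v v'. dist c a < \<eta> \<and> dist v a < \<eta> \<and> dist v' a < \<eta> \<longrightarrow>
     dist (follow c i v) (z (Suc i)) \<le> \<rho> \<and> dist (follow c i v) (follow c i v') \<le> L * dist v v' \<and>
     (follow c i v = follow c i v' \<longrightarrow> v = v')"
  using assms
proof (induction i arbitrary: \<rho>)
  case 0
  then show ?case using z_1 by (intro exI[of _ \<rho>] conjI exI[of _ 1]) auto
next
  case (Suc i)
  obtain K where K: "0 < K" "\<And>u u'. \<lbrakk>norm (u - 1) \<le> 1/2; norm (u' - 1) \<le> 1/2\<rbrakk>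
     \<Longrightarrow> norm (frac_power p q u - frac_power p q u') \<le> K * norm (u - u')"
    using frac_power_Lipschitz by blast
  obtain \<epsilon> where \<epsilon>: "0 < \<epsilon>" "\<epsilon> \<le> 1/2"
    and sep: "\<And>\<omega> u u'. \<lbrakk>\<omega> ^ q = 1; norm (u - 1) \<le> \<epsilon>; norm (u' - 1) \<le> \<epsilon>;
        \<omega> * frac_power p q u = frac_power p q u'\<rbrakk> \<Longrightarrow> \<omega> = 1 \<and> u = u'"
    using frac_power_separation[OF q p] by metis
  define zi where "zi = z (Suc i)"
  define xi where "xi = z (Suc (Suc i)) - a"
  have zi: "zi \<noteq> 0" using n(3)[of "Suc i"] Suc.prems by (simp add: zi_def)
  have xi: "xi \<noteq> 0" using z_Suc[of "Suc i"] zi q p by (auto simp: zero_power zi_def xi_def)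
  define M where "M = norm xi * K / norm zi"
  have M: "0 < M" using xi zi K by (simp add: M_def)
  define \<rho>1 where "\<rho>1 = min (\<epsilon> * norm zi) (\<rho> / (2 * M))"
  have \<rho>1: "0 < \<rho>1" "\<rho>1 \<le> \<epsilon> * norm zi" "M * \<rho>1 \<le> \<rho> / 2"
  proof -
    show "0 < \<rho>1" "\<rho>1 \<le> \<epsilon> * norm zi" using \<epsilon> zi M Suc.prems by (auto simp: \<rho>1_def)
    have "\<rho>1 \<le> \<rho> / (2 * M)" by (simp add: \<rho>1_def)
    then show "M * \<rho>1 \<le> \<rho> / 2" using M by (simp add: field_simps)
  qed
  obtain \<eta> L where \<eta>: "0 < \<eta>" and L: "0 < L"
    and IH: "\<And>c v v'. \<lbrakk>dist c a < \<eta>; dist v a < \<eta>; dist v' a < \<eta>\<rbrakk> \<Longrightarrow>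
     dist (follow c i v) zi \<le> \<rho>1 \<and> dist (follow c i v) (follow c i v') \<le> L * dist v v' \<and>
     (follow c i v = follow c i v' \<longrightarrow> v = v')"
    using Suc.IH[OF _ \<rho>1(1)] Suc.prems unfolding zi_def by (metis Suc_lessD)
  have u: "norm (x / zi - 1) \<le> \<epsilon>" if "dist x zi \<le> \<rho>1" for x
  proof -
    have "x / zi - 1 = (x - zi) / zi" using zi by (simp add: field_simps)
    then have "norm (x / zi - 1) = dist x zi / norm zi" by (simp add: norm_divide dist_norm)
    also have "\<dots> \<le> \<epsilon>" using that \<rho>1 zi by (simp add: field_simps)
    finally show ?thesis .
  qed
  have lip: "dist (near_branch c (Suc i) x) (near_branch c (Suc i) x') \<le> M * dist x x'"
    if "dist x zi \<le> \<rho>1" "dist x' zi \<le> \<rho>1" for c x x'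
  proof -
    have "dist (near_branch c (Suc i) x) (near_branch c (Suc i) x') = norm (xi * (frac_power p q (x / zi) - frac_power p q (x' / zi)))"
      by (simp add: near_branch_def dist_norm xi_def zi_def algebra_simps)
    also have "\<dots> \<le> norm xi * (K * norm (x / zi - x' / zi))"
      unfolding norm_mult using u[OF that(1)] u[OF that(2)] \<epsilon> by (intro mult_left_mono K(2)) auto
    also have "\<dots> = M * dist x x'"
      by (simp add: M_def dist_norm diff_divide_distrib[symmetric] norm_divide)
    finally show ?thesis .
  qed
  have inj: "x = x'" if "dist x zi \<le> \<rho>1" "dist x' zi \<le> \<rho>1" "near_branch c (Suc i) x = near_branch c (Suc i) x'" for c x x'
  proof -
    have "1 * frac_power p q (x / zi) = frac_power p q (x' / zi)"
      using that(3) xi by (simp add: near_branch_def xi_def zi_def)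
    then have "x / zi = x' / zi" using sep[OF power_one u[OF that(1)] u[OF that(2)]] by blast
    then show ?thesis using zi by simp
  qed
  define \<eta>' where "\<eta>' = min \<eta> (\<rho> / 2)"
  show ?case
  proof (rule exI[of _ \<eta>'], rule conjI[OF _ exI[of _ "M * L"]]; (intro conjI allI impI)?)
    show "0 < \<eta>'" "0 < M * L" using \<eta> L M Suc.prems by (auto simp: \<eta>'_def)
    fix c v v' assume "dist c a < \<eta>' \<and> dist v a < \<eta>' \<and> dist v' a < \<eta>'"
    then have d: "dist c a < \<eta>" "dist v a < \<eta>" "dist v' a < \<eta>" "dist c a < \<rho> / 2" by (auto simp: \<eta>'_def)
    have ih: "dist (follow c i v) zi \<le> \<rho>1" "dist (follow c i v') zi \<le> \<rho>1"
      "dist (follow c i v) (follow c i v') \<le> L * dist v v'" "follow c i v = follow c i v' \<Longrightarrow> v = v'"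
      using IH[OF d(1-3)] IH[OF d(1,3,2)] by auto
    have "dist (near_branch c (Suc i) (follow c i v)) (near_branch c (Suc i) zi) \<le> M * dist (follow c i v) zi"
      using lip ih \<rho>1 by simp
    also have "\<dots> \<le> M * \<rho>1" using M ih by (intro mult_left_mono) auto
    finally have "dist (near_branch c (Suc i) (follow c i v)) (near_branch c (Suc i) zi) \<le> \<rho> / 2" using \<rho>1 by simp
    moreover have "dist (near_branch c (Suc i) zi) (z (Suc (Suc i))) = dist c a"
      using zi by (simp add: near_branch_def zi_def dist_norm)
    ultimately show "dist (follow c (Suc i) v) (z (Suc (Suc i))) \<le> \<rho>"
      using dist_triangle[of "near_branch c (Suc i) (follow c i v)" "z (Suc (Suc i))" "near_branch c (Suc i) zi"] d(4) by simp
    have "dist (follow c (Suc i) v) (follow c (Suc i) v') \<le> M * dist (follow c i v) (follow c i v')"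
      using lip ih by simp
    also have "\<dots> \<le> M * (L * dist v v')" using M ih by (intro mult_left_mono) auto
    finally show "dist (follow c (Suc i) v) (follow c (Suc i) v') \<le> M * L * dist v v'" by simp
    show "v = v'" if "follow c (Suc i) v = follow c (Suc i) v'" using inj[OF ih(1,2)] that ih(4) by simp
  qed
qed

lemma follow_uniform:
  assumes "0 < \<rho>"
  obtains \<eta> where "0 < \<eta>" "\<And>c i v v'. \<lbrakk>i < n; dist c a < \<eta>; dist v a < \<eta>; dist v' a < \<eta>\<rbrakk> \<Longrightarrow>
     dist (follow c i v) (z (Suc i)) \<le> \<rho> \<and> dist (follow c i v) (follow c i v') \<le> dist v v' / \<eta> \<and>
     (follow c i v = follow c i v' \<longrightarrow> v = v')"
proof -
  define Q where "Q i \<eta> \<longleftrightarrow> 0 < \<eta> \<and> (\<forall>c v v'. dist c a < \<eta> \<and> dist v a < \<eta> \<and> dist v' a < \<eta> \<longrightarrow>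
     dist (follow c i v) (z (Suc i)) \<le> \<rho> \<and> dist (follow c i v) (follow c i v') \<le> dist v v' / \<eta> \<and>
     (follow c i v = follow c i v' \<longrightarrow> v = v'))" for i \<eta>
  have mono: "Q i \<eta>'" if "Q i \<eta>" "0 < \<eta>'" "\<eta>' \<le> \<eta>" for i \<eta> \<eta>'
    unfolding Q_def
  proof (intro conjI allI impI)
    fix c v v' assume "dist c a < \<eta>' \<and> dist v a < \<eta>' \<and> dist v' a < \<eta>'"
    then have d: "dist c a < \<eta> \<and> dist v a < \<eta> \<and> dist v' a < \<eta>" using that(3) by linarith
    have Q: "dist (follow c i v) (z (Suc i)) \<le> \<rho>" "dist (follow c i v) (follow c i v') \<le> dist v v' / \<eta>"
      "follow c i v = follow c i v' \<longrightarrow> v = v'"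
      using that(1) d unfolding Q_def by blast+
    show "dist (follow c i v) (z (Suc i)) \<le> \<rho>" by (rule Q)
    have "dist v v' / \<eta> \<le> dist v v' / \<eta>'" using that by (intro divide_left_mono) auto
    then show "dist (follow c i v) (follow c i v') \<le> dist v v' / \<eta>'" using Q(2) by linarith
    show "v = v'" if "follow c i v = follow c i v'" using Q(3) that by blast
  qed (fact that(2))
  have "\<exists>\<eta>>0. \<forall>i\<in>{..<n}. Q i \<eta>"
  proof (rule finite_uniform_radius[OF _ _ mono])
    fix i assume "i \<in> {..<n}"
    then obtain \<eta> L where \<eta>: "0 < \<eta>" "0 < L" and loc: "\<And>c v v'. \<lbrakk>dist c a < \<eta>; dist v a < \<eta>; dist v' a < \<eta>\<rbrakk> \<Longrightarrow>
     dist (follow c i v) (z (Suc i)) \<le> \<rho> \<and> dist (follow c i v) (follow c i v') \<le> L * dist v v' \<and>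
     (follow c i v = follow c i v' \<longrightarrow> v = v')"
      using follow_local[OF _ assms, of i] by (metis lessThan_iff)
    define \<eta>' where "\<eta>' = min \<eta> (1 / L)"
    have pos: "0 < \<eta>'" "\<eta>' \<le> \<eta>" using \<eta> by (simp_all add: \<eta>'_def)
    have "L * d \<le> d / \<eta>'" if "0 \<le> d" for d
    proof -
      have "\<eta>' \<le> 1 / L" by (simp add: \<eta>'_def)
      then have "L * \<eta>' \<le> 1" using \<eta> by (simp add: field_simps)
      then have "L * \<eta>' * d \<le> 1 * d" using that by (intro mult_right_mono)
      then show ?thesis using pos by (simp add: field_simps)
    qed
    then have L': "L * dist v v' \<le> dist v v' / \<eta>'" for v v' :: complex by simp
    have "Q i \<eta>'"
      unfolding Q_def
    proof (intro conjI allI impI)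
      fix c v v' assume "dist c a < \<eta>' \<and> dist v a < \<eta>' \<and> dist v' a < \<eta>'"
      then have d: "dist c a < \<eta>" "dist v a < \<eta>" "dist v' a < \<eta>" using pos(2) by linarith+
      show "dist (follow c i v) (z (Suc i)) \<le> \<rho>" using loc[OF d] by blast
      show "dist (follow c i v) (follow c i v') \<le> dist v v' / \<eta>'" using loc[OF d] L'[of v v'] by linarith
      show "v = v'" if "follow c i v = follow c i v'" using loc[OF d] that by blast
    qed (fact pos)
    then show "\<exists>\<eta>>0. Q i \<eta>" using pos by blast
  qed simp_all
  then obtain \<eta> where \<eta>: "0 < \<eta>" "\<And>i. i < n \<Longrightarrow> Q i \<eta>" by auto
  show ?thesis by (rule that[OF \<eta>(1)]) (use \<eta>(2) in \<open>unfold Q_def, blast\<close>)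
qed

end

section \<open>Returns to the critical point\<close>

text \<open>The radius \<open>\<rho>\<close> separates the points of the cycle and isolates the branches that follow it. The single
number \<open>\<eta>\<close> is at the same time a radius around \<open>a\<close> and the inverse of a Lipschitz constant: both
conditions weaken when \<open>\<eta>\<close> decreases, so one choice serves all \<open>i < n\<close>.\<close>
locale charts = simple_centre +
  fixes \<rho> \<eta> :: real
  assumes \<rho>: "0 < \<rho>" and \<eta>: "0 < \<eta>"
    and away_from_0: "\<And>i x. \<lbrakk>0 < i; i < n; dist x (z i) \<le> \<rho>\<rbrakk> \<Longrightarrow> \<rho> \<le> norm x"
    and disjoint: "\<And>i j. \<lbrakk>i < n; j < n; i \<noteq> j\<rbrakk> \<Longrightarrow> cball (z i) \<rho> \<inter> cball (z j) \<rho> = {}"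
    and branch_unique: "\<And>c i x y. \<lbrakk>0 < i; i < n; dist c a \<le> \<rho>; dist x (z i) \<le> \<rho>; dist y (z (Suc i)) \<le> \<rho>;
       y \<in> corr p q c x\<rbrakk> \<Longrightarrow> y = near_branch c i x"
    and follow_close: "\<And>c i v. \<lbrakk>i < n; dist c a < \<eta>; dist v a < \<eta>\<rbrakk> \<Longrightarrow> dist (follow c i v) (z (Suc i)) \<le> \<rho>"
    and follow_lipschitz: "\<And>c i v v'. \<lbrakk>i < n; dist c a < \<eta>; dist v a < \<eta>; dist v' a < \<eta>\<rbrakk>
       \<Longrightarrow> dist (follow c i v) (follow c i v') \<le> dist v v' / \<eta>"
    and follow_inj: "\<And>c i v v'. \<lbrakk>i < n; dist c a < \<eta>; dist v a < \<eta>; dist v' a < \<eta>; follow c i v = follow c i v'\<rbrakk>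
       \<Longrightarrow> v = v'"

lemma (in simple_centre) charts_exist: "\<exists>\<rho> \<eta>. charts p q a z n \<rho> \<eta>"
proof -
  obtain \<rho> where \<rho>: "0 < \<rho>" "\<And>i x. \<lbrakk>0 < i; i < n; dist x (z i) \<le> \<rho>\<rbrakk> \<Longrightarrow> \<rho> \<le> norm x"
    "\<And>i j. \<lbrakk>i < n; j < n; i \<noteq> j\<rbrakk> \<Longrightarrow> cball (z i) \<rho> \<inter> cball (z j) \<rho> = {}"
    "\<And>c i x y. \<lbrakk>0 < i; i < n; dist c a \<le> \<rho>; dist x (z i) \<le> \<rho>; dist y (z (Suc i)) \<le> \<rho>; y \<in> corr p q c x\<rbrakk>
       \<Longrightarrow> y = near_branch c i x"
    by (rule branch_uniqueness) iprover
  obtain \<eta> where \<eta>: "0 < \<eta>" "\<And>c i v v'. \<lbrakk>i < n; dist c a < \<eta>; dist v a < \<eta>; dist v' a < \<eta>\<rbrakk> \<Longrightarrow>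
     dist (follow c i v) (z (Suc i)) \<le> \<rho> \<and> dist (follow c i v) (follow c i v') \<le> dist v v' / \<eta> \<and>
     (follow c i v = follow c i v' \<longrightarrow> v = v')"
    by (rule follow_uniform[OF \<rho>(1)]) iprover
  have "charts p q a z n \<rho> \<eta>"
  proof (intro charts.intro charts_axioms.intro)
    show "simple_centre p q a z n" by (rule simple_centre_axioms)
    show "0 < \<rho>" "0 < \<eta>" by (fact \<rho>(1), fact \<eta>(1))
    show "\<rho> \<le> norm x" if "0 < i" "i < n" "dist x (z i) \<le> \<rho>" for i x by (rule \<rho>(2)[OF that])
    show "cball (z i) \<rho> \<inter> cball (z j) \<rho> = {}" if "i < n" "j < n" "i \<noteq> j" for i j by (rule \<rho>(3)[OF that])
    show "y = near_branch c i x" if "0 < i" "i < n" "dist c a \<le> \<rho>" "dist x (z i) \<le> \<rho>" "dist y (z (Suc i)) \<le> \<rho>"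
      "y \<in> corr p q c x" for c i x y by (rule \<rho>(4)[OF that])
    show "dist (follow c i v) (z (Suc i)) \<le> \<rho>" if "i < n" "dist c a < \<eta>" "dist v a < \<eta>" for c i v
      using \<eta>(2)[OF that that(3)] by blast
    show "dist (follow c i v) (follow c i v') \<le> dist v v' / \<eta>"
      if "i < n" "dist c a < \<eta>" "dist v a < \<eta>" "dist v' a < \<eta>" for c i v v' using \<eta>(2)[OF that] by blast
    show "v = v'"
      if "i < n" "dist c a < \<eta>" "dist v a < \<eta>" "dist v' a < \<eta>" "follow c i v = follow c i v'" for c i v v'
      using \<eta>(2)[OF that(1-4)] that(5) by blast
  qed
  then show ?thesis by blast
qed

context charts begin

text \<open>The univalent part of the return to \<open>0\<close>. The full return of a point \<open>x\<close> near \<open>0\<close> takes the values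
\<open>return_map c (c + \<zeta>)\<close> with \<open>\<zeta>\<^sup>q = x\<^sup>p\<close>; for \<open>x = 0\<close> its only value is \<open>critical_return c\<close>.\<close>
definition return_map :: "complex \<Rightarrow> complex \<Rightarrow> complex" where "return_map c v = follow c (n - 1) v"
definition critical_return :: "complex \<Rightarrow> complex" where "critical_return c = return_map c c"

lemma last_index: "n - 1 < n" "Suc (n - 1) = n" using n by auto

lemma critical_return_small:
  assumes "0 < r"
  shows "\<exists>\<delta>>0. \<forall>c. dist c a < \<delta> \<longrightarrow> norm (critical_return c) \<le> r"
proof -
  obtain \<eta>' where "0 < \<eta>'" "\<And>c. dist c a < \<eta>' \<Longrightarrow> dist (follow c (n - 1) c) (z (Suc (n - 1))) \<le> r"
    using follow_local[OF last_index(1) assms] by blast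
  then show ?thesis unfolding last_index(2) n(2) by (intro exI[of _ \<eta>']) (auto simp: critical_return_def return_map_def)
qed

lemma critical_return_centre: "critical_return a = 0"
proof -
  have "follow a i a = z (Suc i)" if "i < n" for i
    using that
  proof (induction i)
    case 0 then show ?case by (simp add: z_1[unfolded One_nat_def])
  next
    case (Suc i)
    then show ?case using n(3)[of "Suc i"] by (simp add: near_branch_def)
  qed
  from this[OF last_index(1)] show ?thesis by (simp only: critical_return_def return_map_def last_index n(2))
qed

lemma follow_relpow:
  assumes "i < n"
  shows "(v, follow c i v) \<in> corr_rel p q c ^^ i"
  using assms
proof (induction i)
  case (Suc i)
  then have "(follow c i v, follow c (Suc i) v) \<in> corr_rel p q c"
    using follow_corr[of i c v] by (simp add: corr_rel_def)
  then show ?case using Suc by (auto simp del: follow.simps)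
qed simp

lemma critical_return_zero_imp_periodic:
  assumes "critical_return c = 0"
  shows "(0, 0) \<in> corr_rel p q c ^^ n"
proof -
  have "(0, c) \<in> corr_rel p q c" using q p by (simp add: corr_rel_def corr_def zero_power)
  moreover have "(c, 0) \<in> corr_rel p q c ^^ (n - 1)"
    using follow_relpow[OF last_index(1), of c c] assms by (simp add: critical_return_def return_map_def)
  ultimately have "(0, 0) \<in> corr_rel p q c ^^ Suc (n - 1)" by (rule relpow_Suc_I2)
  then show ?thesis by (simp only: last_index)
qed

lemma orbit_follows_branches:
  assumes "dist c a \<le> \<rho>" "forward_orbit p q c y" "\<And>i. i \<le> n \<Longrightarrow> dist (y i) (z i) \<le> \<rho>" "i < n"
  shows "y (Suc i) = follow c i (y 1)"
  using assms(4)
proof (induction i)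
  case (Suc i)
  have "y (Suc (Suc i)) = near_branch c (Suc i) (y (Suc i))"
    using assms Suc.prems by (intro branch_unique) (auto simp: forward_orbit_def)
  then show ?case using Suc by simp
qed simp

text \<open>The first step brings \<open>y 1\<close> within \<open>\<mu> |y 0|\<close> of \<open>c\<close>, the image of \<open>0\<close>; the remaining steps have
Lipschitz constant \<open>1 / \<eta>\<close>. Thus the return of \<open>y 0\<close> is close to the return of \<open>0\<close>.\<close>
lemma return_estimate:
  assumes c: "dist c a \<le> \<rho>" "dist c a < \<eta> / 2" and y: "forward_orbit p q c y"
    and close: "\<And>i. i \<le> n \<Longrightarrow> dist (y i) (z i) \<le> \<rho>"
    and \<mu>: "0 < \<mu>" "\<mu> \<le> 1" and y0: "norm (y 0) \<le> 1" "norm (y 0) \<le> \<mu> ^ q" "norm (y 0) \<le> \<eta> / 2"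
  shows "norm (y 1 - c) \<le> \<mu> * norm (y 0)" "y n = return_map c (y 1)" "norm (y n - critical_return c) \<le> \<mu> / \<eta> * norm (y 0)"
    "dist (y 1) a < \<eta>"
proof -
  have "y (Suc 0) \<in> corr p q c (y 0)" using y by (simp add: forward_orbit_def)
  then show 1: "norm (y 1 - c) \<le> \<mu> * norm (y 0)"
    using \<mu> y0 by (intro norm_root_le[OF q pq]) (auto simp: corr_def)
  show yn: "y n = return_map c (y 1)"
    using orbit_follows_branches[OF c(1) y close last_index(1)] by (simp only: last_index return_map_def)
  have "\<mu> * norm (y 0) \<le> 1 * norm (y 0)" using \<mu> by (intro mult_right_mono) auto
  then have "dist (y 1) c \<le> \<eta> / 2" using 1 y0(3) by (simp add: dist_norm)
  then show y1: "dist (y 1) a < \<eta>" using c(2) dist_triangle[of "y 1" a c] by simp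
  have "dist (follow c (n - 1) (y 1)) (follow c (n - 1) c) \<le> dist (y 1) c / \<eta>"
    using c y1 \<eta> by (intro follow_lipschitz last_index) auto
  also have "\<dots> \<le> \<mu> * norm (y 0) / \<eta>" using 1 \<eta> by (intro divide_right_mono) (auto simp: dist_norm)
  finally show "norm (y n - critical_return c) \<le> \<mu> / \<eta> * norm (y 0)" by (simp add: yn return_map_def critical_return_def dist_norm)
qed

text \<open>If \<open>critical_return c\<close> has modulus at most \<open>r / 2\<close> and the return contracts by the factor \<open>1/2\<close>, the
disc of radius \<open>r\<close> around \<open>0\<close> is invariant under the return. So bounded orbits that start in
it follow the cycle forever.\<close>
lemma trapping:
  obtains r0 where "0 < r0" "\<And>r. \<lbrakk>0 < r; r \<le> r0\<rbrakk> \<Longrightarrow> \<exists>\<delta>>0. \<forall>c y k. dist c a < \<delta> \<and> bounded_orbit p q c y \<and> norm (y 0) \<le> r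
    \<longrightarrow> norm (y (n * k)) \<le> r \<and> (\<forall>i\<le>n. dist (y (n * k + i)) (z i) \<le> \<rho>)"
proof -
  obtain \<delta>A where \<delta>A: "0 < \<delta>A" "\<And>c w i j. \<lbrakk>dist c a < \<delta>A; bounded_orbit p q c w; i < n; j \<le> n; dist (w 0) (z i) \<le> \<delta>A\<rbrakk>
    \<Longrightarrow> dist (w j) (z (i + j)) \<le> \<rho>"
    by (rule shadowing[OF \<rho>]) iprover
  define \<mu> where "\<mu> = min 1 (\<eta> / 2)"
  have \<mu>: "0 < \<mu>" "\<mu> \<le> 1" "\<mu> / \<eta> \<le> 1 / 2" using \<eta> by (auto simp: \<mu>_def field_simps)
  define r0 where "r0 = min (min \<delta>A 1) (min (\<mu> ^ q) (\<eta> / 2))"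
  have r0: "0 < r0" using \<delta>A \<mu> \<eta> by (simp add: r0_def)
  have "\<exists>\<delta>>0. \<forall>c y k. dist c a < \<delta> \<and> bounded_orbit p q c y \<and> norm (y 0) \<le> r
    \<longrightarrow> norm (y (n * k)) \<le> r \<and> (\<forall>i\<le>n. dist (y (n * k + i)) (z i) \<le> \<rho>)" if r: "0 < r" "r \<le> r0" for r
  proof -
    obtain \<delta>b where \<delta>b: "0 < \<delta>b" "\<And>c. dist c a < \<delta>b \<Longrightarrow> norm (critical_return c) \<le> r / 2"
      using critical_return_small[of "r / 2"] r by auto
    define \<delta> where "\<delta> = min (min \<delta>A \<delta>b) (min \<rho> (\<eta> / 2))"
    have "0 < \<delta>" using \<delta>A \<delta>b \<rho> \<eta> by (simp add: \<delta>_def)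
    moreover have "norm (y (n * k)) \<le> r \<and> (\<forall>i\<le>n. dist (y (n * k + i)) (z i) \<le> \<rho>)"
      if c: "dist c a < \<delta>" and y: "bounded_orbit p q c y" and y0: "norm (y 0) \<le> r" for c y k
    proof -
      have close: "dist (u i) (z i) \<le> \<rho>" if "bounded_orbit p q c u" "norm (u 0) \<le> r" "i \<le> n" for u i
        using \<delta>A(2)[of c u 0 i] that c r n by (simp add: \<delta>_def r0_def z_0)
      have step: "norm (u n) \<le> r" if u: "bounded_orbit p q c u" "norm (u 0) \<le> r" for u
      proof -
        have "norm (u n - critical_return c) \<le> \<mu> / \<eta> * norm (u 0)"
          using c r u close[OF u] \<mu> by (intro return_estimate) (auto simp: \<delta>_def r0_def bounded_orbit_def)
        also have "\<dots> \<le> 1 / 2 * r" using \<mu> u \<eta> r by (intro mult_mono) auto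
        finally have "norm (u n - critical_return c) \<le> r / 2" by simp
        moreover have "norm (critical_return c) \<le> r / 2" using \<delta>b c by (simp add: \<delta>_def)
        ultimately show ?thesis using norm_triangle_sub[of "u n" "critical_return c"] by linarith
      qed
      have shift: "bounded_orbit p q c (\<lambda>i. y (n * k + i))" for k
        using bounded_orbit_shift[OF y, of "n * k"] by (simp add: add.commute)
      have nk: "norm (y (n * k)) \<le> r" for k
      proof (induction k)
        case 0 then show ?case using y0 by simp
      next
        case (Suc k)
        have "norm (y (n * k + n)) \<le> r" using step[OF shift[of k]] Suc by simp
        then show ?case by (simp add: add.commute)
      qed
      then show ?thesis using close[OF shift[of k]] by simp
    qed
    ultimately show ?thesis by blast
  qed
  then show ?thesis using that[OF r0] by blast
qed

text \<open>A super-attracting cycle contains \<open>0\<close>. Any other attracting cycle is approached by bounded critical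
orbits, all of which stay in small closed discs around the points of \<open>z\<close>; so its first
point lies in one of these discs, from which shadowing leads to \<open>0\<close>.\<close>
lemma attracting_cycles_enter:
  assumes "0 < r"
  obtains \<delta> where "0 < \<delta>" "\<And>c w. \<lbrakk>dist c a < \<delta>; attracting_cycle p q c w\<rbrakk> \<Longrightarrow>
    \<exists>j. \<forall>k. norm (w (n * k + j)) \<le> r \<and> (\<forall>i\<le>n. dist (w (n * k + i + j)) (z i) \<le> \<rho>)"
proof -
  obtain r0 where r0: "0 < r0" "\<And>r. \<lbrakk>0 < r; r \<le> r0\<rbrakk> \<Longrightarrow> \<exists>\<delta>>0. \<forall>c y k. dist c a < \<delta> \<and> bounded_orbit p q c y \<and> norm (y 0) \<le> r
    \<longrightarrow> norm (y (n * k)) \<le> r \<and> (\<forall>i\<le>n. dist (y (n * k + i)) (z i) \<le> \<rho>)"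
    by (rule trapping) iprover
  \<comment> \<open>The radii are chosen from the end of the itinerary: orbits starting within \<open>\<delta>B\<close> of the cycle enter the
      disc of radius \<open>r1\<close>, and critical orbits, trapped in the disc of radius \<open>r2\<close>, stay within \<open>\<delta>B\<close>.\<close>
  define r1 where "r1 = min r r0"
  have r1: "0 < r1" "r1 \<le> r0" "r1 \<le> r" using assms r0(1) by (auto simp: r1_def)
  obtain \<delta>1 where \<delta>1: "0 < \<delta>1" and trap1: "\<And>c y k. \<lbrakk>dist c a < \<delta>1; bounded_orbit p q c y; norm (y 0) \<le> r1\<rbrakk>
    \<Longrightarrow> norm (y (n * k)) \<le> r1 \<and> (\<forall>i\<le>n. dist (y (n * k + i)) (z i) \<le> \<rho>)"
    using r0(2)[OF r1(1,2)] by blast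
  obtain \<delta>B where \<delta>B: "0 < \<delta>B" and shB: "\<And>c w i j. \<lbrakk>dist c a < \<delta>B; bounded_orbit p q c w; i < n; j \<le> n; dist (w 0) (z i) \<le> \<delta>B\<rbrakk>
    \<Longrightarrow> dist (w j) (z (i + j)) \<le> r1"
    by (rule shadowing[OF r1(1)]) iprover
  obtain \<delta>C where \<delta>C: "0 < \<delta>C" and shC: "\<And>c w i j. \<lbrakk>dist c a < \<delta>C; bounded_orbit p q c w; i < n; j \<le> n; dist (w 0) (z i) \<le> \<delta>C\<rbrakk>
    \<Longrightarrow> dist (w j) (z (i + j)) \<le> \<delta>B"
    by (rule shadowing[OF \<delta>B]) iprover
  define r2 where "r2 = min r1 \<delta>C"
  have r2: "0 < r2" "r2 \<le> r0" "r2 \<le> \<delta>C" using r1 \<delta>C by (auto simp: r2_def)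
  obtain \<delta>2 where \<delta>2: "0 < \<delta>2" and trap2: "\<And>c y k. \<lbrakk>dist c a < \<delta>2; bounded_orbit p q c y; norm (y 0) \<le> r2\<rbrakk>
    \<Longrightarrow> norm (y (n * k)) \<le> r2 \<and> (\<forall>i\<le>n. dist (y (n * k + i)) (z i) \<le> \<rho>)"
    using r0(2)[OF r2(1,2)] by blast
  define \<delta> where "\<delta> = min (min \<delta>1 \<delta>2) (min \<delta>B \<delta>C)"
  have \<delta>: "0 < \<delta>" using \<delta>1 \<delta>2 \<delta>B \<delta>C by (simp add: \<delta>_def)
  have "\<exists>j. \<forall>k. norm (w (n * k + j)) \<le> r \<and> (\<forall>i\<le>n. dist (w (n * k + i + j)) (z i) \<le> \<rho>)"
    if c: "dist c a < \<delta>" and att: "attracting_cycle p q c w" for c w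
  proof -
    have cs: "dist c a < \<delta>1" "dist c a < \<delta>2" "dist c a < \<delta>B" "dist c a < \<delta>C" using c by (auto simp: \<delta>_def)
    obtain m where cyc: "cycle_of_period p q c m w"
      and alt: "(\<exists>i. w i = 0) \<or> (\<forall>i. w i \<noteq> 0) \<and> norm (multiplier p q c w m) < 1"
      using att unfolding attracting_cycle_iff[OF q p] by blast
    have bd: "bounded_orbit p q c w" by (rule cycle_bounded_orbit[OF cyc])
    have "\<exists>j. norm (w j) \<le> r1"
    proof (cases "\<exists>i. w i = 0")
      case True
      then show ?thesis using r1 by (metis less_imp_le norm_zero)
    next
      case False
      then have nz: "\<forall>i. w i \<noteq> 0" "norm (multiplier p q c w m) < 1" using alt by auto
      define A where "A = (\<Union>i<n. cball (z i) \<delta>B)"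
      have crit: "u l \<in> A" if u: "bounded_orbit p q c u" "u 0 = 0" for u l
      proof -
        have "norm (u (n * (l div n))) \<le> r2" using trap2[OF cs(2) u(1)] u(2) r2 by simp
        moreover have "bounded_orbit p q c (\<lambda>i. u (i + n * (l div n)))" by (rule bounded_orbit_shift[OF u(1)])
        moreover have "l mod n \<le> n" "l mod n < n" using n by simp_all
        ultimately have "dist (u (l mod n + n * (l div n))) (z (0 + l mod n)) \<le> \<delta>B"
          using r2 n z_0 by (intro shC[OF cs(4)]) auto
        then show ?thesis using \<open>l mod n < n\<close> by (auto simp: A_def dist_commute)
      qed
      have "w 0 \<in> closure A"
        unfolding closure_approachable
        using attracting_cycle_attracts_critical_orbit[OF q pq cyc nz] crit by metis
      moreover have "closed A" unfolding A_def by (intro closed_UN) auto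
      ultimately have "w 0 \<in> A" by simp
      then obtain i where i: "i < n" "dist (w 0) (z i) \<le> \<delta>B" by (auto simp: A_def dist_commute)
      have "dist (w (n - i)) (z (i + (n - i))) \<le> r1" using shB[OF cs(3) bd i(1) _ i(2)] by simp
      then show ?thesis using i n by auto
    qed
    then obtain j where j: "norm (w j) \<le> r1" by blast
    have bdj: "bounded_orbit p q c (\<lambda>i. w (i + j))" by (rule bounded_orbit_shift[OF bd])
    have "norm (w (n * k + j)) \<le> r \<and> (\<forall>i\<le>n. dist (w (n * k + i + j)) (z i) \<le> \<rho>)" for k
      using trap1[OF cs(1) bdj, of k] j r1(3) by simp
    then show ?thesis by blast
  qed
  then show ?thesis using that[OF \<delta>] by blast
qed

end

section \<open>Attracting cycles and the return map\<close>

context charts begin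

text \<open>Along a cycle the largest modulus among the returns is attained at a return of another point of the
cycle, which is possible only if it is at most \<open>2 |critical_return c|\<close>. Inserting this bound
into the return estimate once more localises all returns near \<open>critical_return c\<close>.\<close>
lemma cycle_core:
  assumes c: "dist c a \<le> \<rho>" "dist c a < \<eta> / 2" and \<mu>: "0 < \<mu>" "\<mu> \<le> 1" "\<mu> / \<eta> \<le> 1 / 4"
    and cyc: "cycle_of_period p q c m y"
    and enter: "\<And>k. norm (y (n * k)) \<le> min 1 (min (\<mu> ^ q) (\<eta> / 2))"
      "\<And>k i. i \<le> n \<Longrightarrow> dist (y (n * k + i)) (z i) \<le> \<rho>"
  shows "norm (y (n * k)) \<le> 2 * norm (critical_return c)"
    "norm (y (Suc (n * k)) - c) \<le> \<mu> * norm (y (n * k))"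
    "norm (y (n * k) - critical_return c) \<le> \<mu> / \<eta> * (2 * norm (critical_return c))"
    "i < n \<Longrightarrow> y (Suc (n * k + i)) = follow c i (y (Suc (n * k)))"
proof -
  have m: "0 < m" and per: "\<And>i. y (i + m) = y i" and fo: "forward_orbit p q c y"
    using cyc by (auto simp: cycle_of_period_def)
  define u where "u k = (\<lambda>i. y (n * k + i))" for k
  have fou: "forward_orbit p q c (u k)" for k using fo by (simp add: u_def forward_orbit_def)
  have est: "norm (u k 1 - c) \<le> \<mu> * norm (u k 0)" "norm (u k n - critical_return c) \<le> \<mu> / \<eta> * norm (u k 0)" for k
    using return_estimate[OF c fou[of k] _ \<mu>(1,2)] enter(2)[of _ k] enter(1)[of k] by (simp_all add: u_def)
  show "norm (y (Suc (n * k)) - c) \<le> \<mu> * norm (y (n * k))" using est(1)[of k] by (simp add: u_def)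
  show "y (Suc (n * k + i)) = follow c i (y (Suc (n * k)))" if "i < n"
    using orbit_follows_branches[OF c(1) fou[of k] _ that] enter(2)[of _ k] by (simp add: u_def)
  have ret: "norm (y (n * Suc k) - critical_return c) \<le> \<mu> / \<eta> * norm (y (n * k))" for k
    using est(2)[of k] by (simp add: u_def add.commute)
  have bound: "norm (y (n * k)) \<le> 2 * norm (critical_return c)" for k
  proof (rule periodic_contraction_bound[OF m, of "\<lambda>k. norm (y (n * k))"])
    show "norm (y (n * (k + m))) = norm (y (n * k))" for k
      using periodic_add_mult[of y m "n * k" n, OF per] by (simp add: algebra_simps)
    show "norm (y (n * Suc k)) \<le> norm (critical_return c) + norm (y (n * k)) / 4" for k
    proof -
      have "\<mu> / \<eta> * norm (y (n * k)) \<le> 1 / 4 * norm (y (n * k))" using \<mu> by (intro mult_right_mono) auto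
      then show ?thesis using ret[of k] norm_triangle_sub[of "y (n * Suc k)" "critical_return c"] by linarith
    qed
  qed simp
  show "norm (y (n * k)) \<le> 2 * norm (critical_return c)" by (rule bound)
  \<comment> \<open>By periodicity \<open>y (n * k)\<close> is itself the return of an earlier point of the cycle.\<close>
  have "Suc (k + (m - 1)) = k + m" using m by simp
  then have "y (n * k) = y (n * Suc (k + (m - 1)))"
    using periodic_add_mult[of y m "n * k" n, OF per] by (simp only:) (simp add: algebra_simps)
  then have "norm (y (n * k) - critical_return c) \<le> \<mu> / \<eta> * norm (y (n * (k + (m - 1))))" using ret by simp
  also have "\<dots> \<le> \<mu> / \<eta> * (2 * norm (critical_return c))" using \<mu> \<eta> by (intro mult_left_mono bound) auto
  finally show "norm (y (n * k) - critical_return c) \<le> \<mu> / \<eta> * (2 * norm (critical_return c))" .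
qed

lemma cycle_enters_shifted:
  assumes "attracting_cycle p q c w" "\<forall>k. norm (w (n * k + j)) \<le> r \<and> (\<forall>i\<le>n. dist (w (n * k + i + j)) (z i) \<le> \<rho>)"
  obtains m y where "cycle_of_period p q c m y" "range y = range w" "\<And>k. norm (y (n * k)) \<le> r"
    "\<And>k i. i \<le> n \<Longrightarrow> dist (y (n * k + i)) (z i) \<le> \<rho>"
proof -
  obtain m where cyc: "cycle_of_period p q c m w" using assms(1) by (auto simp: attracting_cycle_def)
  show ?thesis
    by (rule that[OF cycle_shift[OF cyc, of j] cycle_range_shift[OF cyc]]) (use assms(2) in auto)
qed

text \<open>For \<open>c = a\<close> the localisation of the returns reads \<open>|y| \<le> 2 |critical_return a| = 0\<close>. So every
attracting cycle contains \<open>0\<close>, and by uniqueness of the bounded orbit of \<open>0\<close> it is a shift of \<open>z\<close>.\<close>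
lemma finite_dual_julia_centre: "finite (dual_julia p q a)"
proof -
  define \<mu> where "\<mu> = min 1 (\<eta> / 4)"
  have \<mu>: "0 < \<mu>" "\<mu> \<le> 1" "\<mu> / \<eta> \<le> 1 / 4" using \<eta> by (auto simp: \<mu>_def field_simps)
  define r where "r = min 1 (min (\<mu> ^ q) (\<eta> / 2))"
  have "0 < r" using \<mu> \<eta> by (simp add: r_def)
  then obtain \<delta> where "0 < \<delta>" and enter: "\<And>c w. \<lbrakk>dist c a < \<delta>; attracting_cycle p q c w\<rbrakk> \<Longrightarrow>
    \<exists>j. \<forall>k. norm (w (n * k + j)) \<le> r \<and> (\<forall>i\<le>n. dist (w (n * k + i + j)) (z i) \<le> \<rho>)"
    by (rule attracting_cycles_enter) iprover
  have sub: "range w \<subseteq> range z" if att: "attracting_cycle p q a w" for w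
  proof -
    have "dist a a < \<delta>" using \<open>0 < \<delta>\<close> by simp
    from enter[OF this att] obtain j where "\<forall>k. norm (w (n * k + j)) \<le> r \<and> (\<forall>i\<le>n. dist (w (n * k + i + j)) (z i) \<le> \<rho>)"
      by blast
    then obtain m y where y: "cycle_of_period p q a m y" "range y = range w" "\<And>k. norm (y (n * k)) \<le> r"
      "\<And>k i. i \<le> n \<Longrightarrow> dist (y (n * k + i)) (z i) \<le> \<rho>"
      by (rule cycle_enters_shifted[OF att]) iprover
    have "norm (y (n * 0)) \<le> 2 * norm (critical_return a)"
      by (rule cycle_core(1)[OF _ _ \<mu> y(1) y(3)[unfolded r_def] y(4)]) (use \<rho> \<eta> in auto)
    then have "y 0 = 0" using critical_return_centre by simp
    then have "y = z" by (intro z_unique cycle_bounded_orbit[OF y(1)])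
    then show ?thesis using y(2) by simp
  qed
  have "z i = z (i mod n)" for i
    using periodic_add_mult[of z n "i mod n" "i div n", OF z_periodic] by simp
  then have "range z \<subseteq> z ` {..<n}" using n(1) by (metis image_subset_iff imageI lessThan_iff mod_less_divisor)
  then have fin: "finite (range z)" by (rule finite_subset) simp
  have "\<Union>{range w |w. attracting_cycle p q a w} \<subseteq> range z" using sub by blast
  then have "finite (\<Union>{range w |w. attracting_cycle p q a w})" using fin finite_subset by blast
  then show ?thesis unfolding dual_julia_def by (simp add: finite_imp_closed)
qed

definition R :: real where "R = max (3 ^ q) (norm a + \<eta>)"
text \<open>A bound for the modulus of the derivative of a branch at the points of a cycle near \<open>z i\<close>, \<open>0 < i < n\<close>;
their distance from \<open>0\<close> is at least \<open>\<rho>\<close> and their images have modulus at most \<open>R\<close>.\<close>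
definition C :: real where "C = max 1 (real p / real q * (2 * R) / \<rho>)"

end

section \<open>The iterated function system of a perturbed parameter\<close>

text \<open>A parameter \<open>c\<close> near \<open>a\<close> for which \<open>0\<close> does not return to \<open>0\<close>. The number \<open>\<epsilon>\<close> is the relative radius of
the disc around \<open>critical_return c\<close> on which the \<open>q\<close> branches of the power are separated, and \<open>K\<close> is a
Lipschitz constant of the power. The smallness conditions on \<open>\<mu>\<close> ensure in turn that the returns
fall into this disc, that the branches of the return contract by \<open>1/2\<close>, and that the resulting cycles
are attracting.\<close>
locale perturbation = charts +
  fixes c :: complex and K \<epsilon> \<mu> :: real
  assumes K: "0 < K" "\<And>u u'. \<lbrakk>norm (u - 1) \<le> 1/2; norm (u' - 1) \<le> 1/2\<rbrakk>
       \<Longrightarrow> norm (frac_power p q u - frac_power p q u') \<le> K * norm (u - u')"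
    and \<epsilon>: "0 < \<epsilon>" "\<epsilon> \<le> 1/2"
    and power_bound: "\<And>u. norm (u - 1) \<le> \<epsilon> \<Longrightarrow> norm (frac_power p q u) \<le> 2"
    and power_sep: "\<And>\<omega> u u'. \<lbrakk>\<omega> ^ q = 1; norm (u - 1) \<le> \<epsilon>; norm (u' - 1) \<le> \<epsilon>;
        \<omega> * frac_power p q u = frac_power p q u'\<rbrakk> \<Longrightarrow> \<omega> = 1 \<and> u = u'"
    and \<mu>: "0 < \<mu>" "\<mu> \<le> 1" "2 * \<mu> \<le> \<epsilon> * \<eta>" "\<mu> * K \<le> \<eta> / 2" "C ^ (n - 1) * (real p / real q * (4 * \<mu>)) < 1"
    and c: "dist c a \<le> \<rho>" "dist c a < \<eta> / 2" "critical_return c \<noteq> 0" "norm (critical_return c) \<le> 1" "norm (critical_return c) \<le> \<mu> ^ q"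
    and enter: "\<And>w. attracting_cycle p q c w \<Longrightarrow> \<exists>j. \<forall>k. norm (w (n * k + j)) \<le> min 1 (min (\<mu> ^ q) (\<eta> / 2)) \<and>
       (\<forall>i\<le>n. dist (w (n * k + i + j)) (z i) \<le> \<rho>)"
begin

definition \<beta> :: complex where "\<beta> = frac_power p q (critical_return c)"
text \<open>The branches of the return, one for each \<open>q\<close>-th root of unity. They are taken from \<open>c\<close> to \<open>c\<close>
rather than from \<open>critical_return c\<close> to itself, because from a point near \<open>c\<close> the whole passage along
the cycle is single-valued; so the \<open>n\<close> pieces of the dual Julia set are images of one limit set
under the maps \<open>follow c i\<close>.\<close>
definition E :: "complex \<Rightarrow> complex \<Rightarrow> complex" where
  "E \<omega> v = c + \<omega> * \<beta> * frac_power p q (return_map c v / critical_return c)"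
definition I :: "complex set" where "I = {\<omega>. \<omega> ^ q = 1}"
definition B :: "complex set" where "B = cball c (2 * norm \<beta>)"

lemma \<beta>: "\<beta> ^ q = critical_return c ^ p" "\<beta> \<noteq> 0" "norm \<beta> \<le> \<mu> * norm (critical_return c)"
proof -
  show *: "\<beta> ^ q = critical_return c ^ p" unfolding \<beta>_def by (rule frac_power_power[OF q p])
  show "\<beta> \<noteq> 0" using c by (simp add: \<beta>_def)
  show "norm \<beta> \<le> \<mu> * norm (critical_return c)" using * c \<mu> by (intro norm_root_le[OF q pq]) auto
qed

lemma c_near: "dist c a < \<eta>" using c(2) \<eta> by linarith

lemma B_near:
  assumes "v \<in> B"
  shows "dist v a < \<eta>"
proof -
  have "dist v c \<le> 2 * (\<mu> * norm (critical_return c))" using assms \<beta>(3) by (simp add: B_def dist_commute)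
  also have "\<dots> \<le> 2 * (\<mu> * 1)" using c \<mu> by (intro mult_left_mono) auto
  also have "\<dots> \<le> 1 / 2 * \<eta>" using \<mu>(3) \<epsilon> \<eta> mult_right_mono[of \<epsilon> "1/2" \<eta>] by linarith
  finally show ?thesis using dist_triangle[of v a c] c(2) by linarith
qed

lemma c_in_B: "c \<in> B" by (simp add: B_def)

lemma norm_unity: "\<omega> \<in> I \<Longrightarrow> norm \<omega> = 1"
  using power_eq_imp_eq_norm[of \<omega> q 1] q by (simp add: I_def)

lemma ratio_near_1: "norm (x - critical_return c) \<le> \<epsilon> * norm (critical_return c) \<Longrightarrow> norm (x / critical_return c - 1) \<le> \<epsilon>"
proof -
  assume *: "norm (x - critical_return c) \<le> \<epsilon> * norm (critical_return c)"
  have "x / critical_return c - 1 = (x - critical_return c) / critical_return c" using c by (simp add: field_simps)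
  then show ?thesis using * c by (simp add: norm_divide field_simps)
qed

lemma return_map_lipschitz: "\<lbrakk>v \<in> B; v' \<in> B\<rbrakk> \<Longrightarrow> norm (return_map c v - return_map c v') \<le> norm (v - v') / \<eta>"
  using follow_lipschitz[OF last_index(1) c_near B_near B_near, of v v'] by (simp add: return_map_def dist_norm)

lemma return_map_near:
  assumes "v \<in> B"
  shows "norm (return_map c v - critical_return c) \<le> \<epsilon> * norm (critical_return c)"
proof -
  have "norm (return_map c v - critical_return c) \<le> norm (v - c) / \<eta>" unfolding critical_return_def by (rule return_map_lipschitz[OF assms c_in_B])
  also have "\<dots> \<le> 2 * (\<mu> * norm (critical_return c)) / \<eta>"
    using assms \<beta>(3) \<eta> by (intro divide_right_mono) (auto simp: B_def dist_norm norm_minus_commute)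
  also have "\<dots> = 2 * \<mu> * norm (critical_return c) / \<eta>" by simp
  also have "\<dots> \<le> \<epsilon> * \<eta> * norm (critical_return c) / \<eta>"
    using \<mu>(3) \<eta> by (intro divide_right_mono mult_right_mono) auto
  finally show ?thesis using \<eta> by simp
qed

lemma return_map_bounds:
  assumes "v \<in> B"
  shows "norm (critical_return c) / 2 \<le> norm (return_map c v)"
proof -
  have "\<epsilon> * norm (critical_return c) \<le> 1/2 * norm (critical_return c)" using \<epsilon> by (intro mult_right_mono) auto
  then show ?thesis using return_map_near[OF assms] norm_triangle_sub[of "critical_return c" "return_map c v"]
    by (simp add: norm_minus_commute)
qed

lemma norm_E:
  assumes "\<omega> \<in> I" "v \<in> B"
  shows "norm (E \<omega> v - c) \<le> 2 * norm \<beta>"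
proof -
  have "norm (E \<omega> v - c) = norm \<beta> * norm (frac_power p q (return_map c v / critical_return c))"
    using norm_unity[OF assms(1)] by (simp add: E_def norm_mult)
  also have "\<dots> \<le> norm \<beta> * 2"
    by (intro mult_left_mono power_bound ratio_near_1 return_map_near assms(2)) simp
  finally show ?thesis by simp
qed

lemma E_corr:
  assumes "\<omega> \<in> I"
  shows "E \<omega> v \<in> corr p q c (return_map c v)"
  using assms \<beta>(1) c frac_power_power[OF q p, of "return_map c v / critical_return c"]
  by (simp add: corr_def E_def I_def power_mult_distrib power_divide)

lemma E_surj:
  assumes "y \<in> corr p q c x" "norm (x - critical_return c) \<le> \<epsilon> * norm (critical_return c)" "x = return_map c v"
  shows "\<exists>\<omega>\<in>I. y = E \<omega> v"
proof -
  define t where "t = \<beta> * frac_power p q (x / critical_return c)"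
  have x: "x \<noteq> 0"
  proof
    assume "x = 0"
    then have "norm (critical_return c) \<le> \<epsilon> * norm (critical_return c)" using assms by simp
    also have "\<dots> \<le> 1/2 * norm (critical_return c)" using \<epsilon> by (intro mult_right_mono) auto
    finally show False using c by simp
  qed
  have t: "t \<noteq> 0" using \<beta>(2) x c by (simp add: t_def)
  have "t ^ q = x ^ p" using \<beta>(1) c frac_power_power[OF q p, of "x / critical_return c"]
    by (simp add: t_def power_mult_distrib power_divide)
  then have "((y - c) / t) ^ q = 1" using assms(1) x by (simp add: corr_def power_divide)
  moreover have "y = E ((y - c) / t) v" using t assms(3) by (simp add: E_def t_def)
  ultimately show ?thesis unfolding I_def by blast
qed

lemma ifs: "separated_ifs E I B (1/2)" if "2 \<le> q"
proof
  show "finite I" unfolding I_def using q by (intro finite_roots_unity)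
  show "2 \<le> card I" unfolding I_def using that by (subst card_roots_unity_eq) auto
  show "compact B" "B \<noteq> {}" by (auto simp: B_def)
  show "0 \<le> (1/2::real)" "(1/2::real) < 1" by simp_all
  show "E \<omega> v \<in> B" if "\<omega> \<in> I" "v \<in> B" for \<omega> v
    using norm_E[OF that] by (simp add: B_def dist_norm norm_minus_commute)
  fix \<omega> v v' assume \<omega>: "\<omega> \<in> I" and v: "v \<in> B" "v' \<in> B"
  let ?u = "return_map c v / critical_return c" and ?u' = "return_map c v' / critical_return c"
  have "dist (E \<omega> v) (E \<omega> v') = norm (\<omega> * \<beta> * (frac_power p q ?u - frac_power p q ?u'))"
    by (simp add: E_def dist_norm right_diff_distrib)
  also have "\<dots> = norm \<beta> * norm (frac_power p q ?u - frac_power p q ?u')"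
    using norm_unity[OF \<omega>] by (simp add: norm_mult)
  also have "\<dots> \<le> norm \<beta> * (K * norm (?u - ?u'))"
    using ratio_near_1[OF return_map_near[OF v(1)]] ratio_near_1[OF return_map_near[OF v(2)]] \<epsilon>
    by (intro mult_left_mono K) auto
  also have "norm (?u - ?u') = norm (return_map c v - return_map c v') / norm (critical_return c)"
    by (simp add: diff_divide_distrib[symmetric] norm_divide)
  also have "norm \<beta> * (K * (norm (return_map c v - return_map c v') / norm (critical_return c))) \<le>
      (\<mu> * norm (critical_return c)) * (K * ((norm (v - v') / \<eta>) / norm (critical_return c)))"
    using \<beta>(3) return_map_lipschitz[OF v] K(1) \<mu>(1) by (intro mult_mono divide_right_mono) auto
  also have "\<dots> = \<mu> * K * (norm (v - v') / \<eta>)" using c by simp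
  also have "\<dots> \<le> \<eta> / 2 * (norm (v - v') / \<eta>)" using \<mu>(4) \<eta> by (intro mult_right_mono) auto
  also have "\<dots> = 1/2 * dist v v'" using \<eta> by (simp add: dist_norm)
  finally show "dist (E \<omega> v) (E \<omega> v') \<le> 1/2 * dist v v'" .
next
  fix \<omega> \<omega>' v v' assume \<omega>: "\<omega> \<in> I" "\<omega>' \<in> I" and v: "v \<in> B" "v' \<in> B" and eq: "E \<omega> v = E \<omega>' v'"
  let ?u = "return_map c v / critical_return c" and ?u' = "return_map c v' / critical_return c"
  have nz: "\<omega>' \<noteq> 0" using \<omega> q by (auto simp: I_def zero_power)
  have "\<omega> * frac_power p q ?u = \<omega>' * frac_power p q ?u'" using eq \<beta>(2) by (simp add: E_def)
  then have "(\<omega> / \<omega>') * frac_power p q ?u = frac_power p q ?u'" using nz by (simp add: field_simps)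
  moreover have "(\<omega> / \<omega>') ^ q = 1" using \<omega> by (simp add: I_def power_divide)
  ultimately have 1: "\<omega> / \<omega>' = 1 \<and> ?u = ?u'"
    using ratio_near_1[OF return_map_near[OF v(1)]] ratio_near_1[OF return_map_near[OF v(2)]] by (intro power_sep)
  then have "return_map c v = return_map c v'" using c by simp
  then have "v = v'" unfolding return_map_def by (rule follow_inj[OF last_index(1) c_near B_near[OF v(1)] B_near[OF v(2)]])
  then show "\<omega> = \<omega>' \<and> v = v'" using 1 nz by simp
qed

abbreviation Fix where "Fix \<equiv> word_fixpoints E I B"

text \<open>The points \<open>v k\<close> of the cycle near \<open>c\<close> satisfy \<open>v (Suc k) = E \<omega> (v k)\<close> for suitable roots of unity \<open>\<omega>\<close>, hence
are fixed by words; the other points are reached from them by the maps \<open>follow c i\<close>.\<close>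
lemma attracting_cycle_subset:
  assumes "2 \<le> q" "attracting_cycle p q c w"
  shows "range w \<subseteq> (\<Union>i<n. follow c i ` Fix)"
proof -
  interpret separated_ifs E I B "1/2" by (rule ifs[OF assms(1)])
  obtain j where "\<forall>k. norm (w (n * k + j)) \<le> min 1 (min (\<mu> ^ q) (\<eta> / 2)) \<and>
       (\<forall>i\<le>n. dist (w (n * k + i + j)) (z i) \<le> \<rho>)" using enter[OF assms(2)] by blast
  then obtain m y where cyc: "cycle_of_period p q c m y" and y: "range y = range w"
    "\<And>k. norm (y (n * k)) \<le> min 1 (min (\<mu> ^ q) (\<eta> / 2))"
    "\<And>k i. i \<le> n \<Longrightarrow> dist (y (n * k + i)) (z i) \<le> \<rho>"
    by (rule cycle_enters_shifted[OF assms(2)]) iprover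
  have m: "0 < m" and per: "\<And>i. y (i + m) = y i" and fo: "forward_orbit p q c y"
    using cyc by (auto simp: cycle_of_period_def)
  have "2 * \<mu> \<le> 1/2 * \<eta>" using \<mu>(3) \<epsilon>(2) \<eta> mult_right_mono[of \<epsilon> "1/2" \<eta>] by linarith
  then have \<mu>4: "\<mu> / \<eta> \<le> 1/4" using \<eta> by (simp add: field_simps)
  note core = cycle_core[OF c(1,2) \<mu>(1,2) \<mu>4 cyc y(2)]
  have core3: "norm (y (n * k) - critical_return c) \<le> \<mu> / \<eta> * (2 * norm (critical_return c))" for k
    by (intro core(3) y(3))
  have core4: "y (Suc (n * k + i)) = follow c i (y (Suc (n * k)))" if "i < n" for k i
    using that by (intro core(4) y(3))
  have x: "norm (y (n * k) - critical_return c) \<le> \<epsilon> * norm (critical_return c)" for k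
  proof -
    have "\<mu> / \<eta> * (2 * norm (critical_return c)) = 2 * \<mu> * norm (critical_return c) / \<eta>" by simp
    also have "\<dots> \<le> \<epsilon> * \<eta> * norm (critical_return c) / \<eta>"
      using \<mu>(3) \<eta> by (intro divide_right_mono mult_right_mono) auto
    also have "\<dots> = \<epsilon> * norm (critical_return c)" using \<eta> by simp
    finally show ?thesis using core3[of k] by linarith
  qed
  define v where "v k = y (Suc (n * k))" for k
  have gv: "return_map c (v k) = y (n * Suc k)" for k
    using core4[OF last_index(1), of k] last_index by (simp add: return_map_def v_def add.commute)
  have vB: "v (Suc k) \<in> B \<and> (\<exists>\<omega>\<in>I. v (Suc k) = E \<omega> (v k))" for k
  proof
    have "v (Suc k) \<in> corr p q c (y (n * Suc k))" using fo unfolding v_def forward_orbit_def by blast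
    then show "\<exists>\<omega>\<in>I. v (Suc k) = E \<omega> (v k)" by (rule E_surj[OF _ x gv[symmetric]])
    then obtain \<omega> where \<omega>: "\<omega> \<in> I" "v (Suc k) = E \<omega> (v k)" by blast
    have "norm (frac_power p q (y (n * Suc k) / critical_return c)) \<le> 2" by (intro power_bound ratio_near_1 x)
    then have "norm (v (Suc k) - c) \<le> norm \<beta> * 2"
      unfolding \<omega>(2) E_def gv using norm_unity[OF \<omega>(1)] by (simp add: norm_mult mult_left_mono)
    then show "v (Suc k) \<in> B" by (simp add: B_def dist_norm norm_minus_commute mult.commute)
  qed
  have vper: "v (k + m) = v k" for k
    using periodic_add_mult[of y m "Suc (n * k)" n, OF per] by (simp add: v_def algebra_simps)
  have vB': "v k \<in> B" for k using vB[of "k + (m - 1)"] vper[of k] m by simp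
  have vP: "v k \<in> Fix" for k
  proof -
    have "v (k + 0) = v k \<and> (\<forall>l. v (k + l) \<in> B \<and> (\<exists>\<omega>\<in>I. v (k + Suc l) = E \<omega> (v (k + l)))) \<and>
      (\<forall>l. v (k + (l + m)) = v (k + l))"
      using vB' vB vper by (simp add: add.assoc[symmetric])
    then show ?thesis unfolding word_fixpoint_iff_periodic using m
      by (intro exI[of _ m] conjI exI[of _ "\<lambda>l. v (k + l)"]) auto
  qed
  have "range w = range (\<lambda>l. y (l + 1))" using cycle_range_shift[OF cyc, of 1] y(1) by simp
  moreover have "y (l + 1) \<in> (\<Union>i<n. follow c i ` Fix)" for l
  proof -
    have "l mod n < n" using n(1) by simp
    moreover have "y (l + 1) = follow c (l mod n) (v (l div n))"
      using core4[OF \<open>l mod n < n\<close>, of "l div n"] by (simp add: v_def)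
    ultimately show ?thesis using vP by blast
  qed
  ultimately show ?thesis by auto
qed

text \<open>The multiplier of the resulting cycle is a product over the returns. Each return contributes at most
\<open>C\<close> for each of the \<open>n - 1\<close> steps away from \<open>0\<close>, and \<open>(p/q) 4 \<mu>\<close> for the step near \<open>0\<close>, where the
derivative of the power is small.\<close>
lemma fixpoint_orbit_attracting:
  assumes "2 \<le> q" "x \<in> Fix"
  shows "\<exists>u. attracting_cycle p q c u \<and> (\<forall>i<n. u i = follow c i x)"
proof -
  interpret separated_ifs E I B "1/2" by (rule ifs[OF assms(1)])
  obtain N v where N: "0 < N" and v: "v 0 = x" "\<And>k. v k \<in> B" "\<And>k. \<exists>\<omega>\<in>I. v (Suc k) = E \<omega> (v k)"
    "\<And>k. v (k + N) = v k" using assms(2) unfolding word_fixpoint_iff_periodic by blast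
  \<comment> \<open>The time \<open>l\<close> is counted from the point near \<open>c\<close>: the index \<open>n * k + (n - 1)\<close> belongs to the point
      near \<open>0\<close>, from which the step \<open>E\<close> leads to the next point near \<open>c\<close>.\<close>
  define u where "u l = follow c (l mod n) (v (l div n))" for l
  have u: "u (n * k + i) = follow c i (v k)" if "i < n" for k i using that by (simp add: u_def)
  have u_last: "u (n * k + (n - 1)) = return_map c (v k)" for k using u[OF last_index(1)] by (simp add: return_map_def)
  have u_next: "u (Suc (n * k + (n - 1))) = v (Suc k)" for k
  proof -
    have "Suc (n * k + (n - 1)) = n * Suc k + 0" using n(1) by simp
    then show ?thesis using u[of 0 "Suc k"] n(1) by (simp only: follow.simps)
  qed
  have split: "\<exists>k i. l = n * k + i \<and> i < n" for l
    using n(1) by (intro exI[of _ "l div n"] exI[of _ "l mod n"]) (simp add: mult.commute)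
  have dec: "(\<exists>k i. l = n * k + i \<and> Suc i < n) \<or> (\<exists>k. l = n * k + (n - 1))" for l
  proof -
    obtain k i where ki: "l = n * k + i" "i < n" using split by blast
    show ?thesis
    proof (cases "Suc i < n")
      case True
      then show ?thesis using ki by blast
    next
      case False
      then have "i = n - 1" using ki(2) by simp
      then show ?thesis using ki(1) by blast
    qed
  qed
  have fo: "u (Suc l) \<in> corr p q c (u l)" for l
    using dec[of l]
  proof (elim disjE exE conjE)
    fix k i assume l: "l = n * k + i" and i: "Suc i < n"
    have "u (Suc l) = follow c (Suc i) (v k)" using u[OF i, of k] l by simp
    moreover have "u l = follow c i (v k)" using u[of i k] i l by simp
    ultimately show ?thesis using follow_corr[OF i, of c "v k"] by simp
  next
    fix k assume l: "l = n * k + (n - 1)"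
    obtain \<omega> where "\<omega> \<in> I" "v (Suc k) = E \<omega> (v k)" using v(3) by blast
    then show ?thesis using E_corr[of \<omega> "v k"] unfolding l u_last u_next by simp
  qed
  have per: "u (l + n * N) = u l" for l
  proof -
    obtain k i where "l = n * k + i" "i < n" using split by blast
    then show ?thesis using u[of i k] u[of i "k + N"] v(4)[of k] by (simp add: algebra_simps)
  qed
  have cyc: "cycle_of_period p q c (n * N) u"
    using n(1) N fo per by (simp add: cycle_of_period_def forward_orbit_def)
  have small: "\<rho> \<le> norm (u (n * k + i))" if "Suc i < n" for k i
  proof -
    have "dist (follow c i (v k)) (z (Suc i)) \<le> \<rho>"
      using that by (intro follow_close c_near B_near v(2)) auto
    then have "\<rho> \<le> norm (follow c i (v k))" using that by (intro away_from_0[of "Suc i"]) auto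
    then show ?thesis using u[of i k] that by simp
  qed
  have nz: "u l \<noteq> 0" for l
    using dec[of l]
  proof (elim disjE exE conjE)
    fix k i assume "l = n * k + i" and "Suc i < n"
    then show ?thesis using small[of i k] \<rho> by auto
  next
    fix k assume "l = n * k + (n - 1)"
    then show ?thesis using return_map_bounds[OF v(2)[of k]] c(3) u_last[of k] by auto
  qed
  have uR: "norm (u l) \<le> R" and cR: "norm c \<le> R" for l
  proof -
    have "norm c \<le> norm a + \<eta>" using c_near norm_triangle_sub[of c a] by (simp add: dist_norm)
    then show "norm c \<le> R" by (simp add: R_def)
    then show "norm (u l) \<le> R"
      by (intro bounded_orbit_norm_le[OF q pq cycle_bounded_orbit[OF cyc]]) (auto simp: R_def)
  qed
  have R0: "0 \<le> R" using cR norm_ge_zero[of c] by linarith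
  define \<kappa> where "\<kappa> l = norm (of_nat p / of_nat q * (u (Suc l) - c) / u l)" for l
  have \<kappa>: "\<kappa> l = real p / real q * norm (u (Suc l) - c) / norm (u l)" for l
    by (simp add: \<kappa>_def norm_mult norm_divide)
  have \<kappa>C: "\<kappa> (n * k + i) \<le> C" if "Suc i < n" for k i
  proof -
    have "norm (u (Suc (n * k + i)) - c) \<le> 2 * R"
      using norm_triangle_ineq4[of "u (Suc (n * k + i))" c] uR[of "Suc (n * k + i)"] cR by linarith
    then have "\<kappa> (n * k + i) \<le> real p / real q * (2 * R) / \<rho>"
      unfolding \<kappa> using small[OF that, of k] \<rho> R0 by (intro frac_le mult_left_mono) auto
    then show ?thesis by (simp add: C_def)
  qed
  have \<kappa>last: "\<kappa> (n * k + (n - 1)) \<le> real p / real q * (4 * \<mu>)" for k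
  proof -
    obtain \<omega> where \<omega>: "\<omega> \<in> I" "v (Suc k) = E \<omega> (v k)" using v(3) by blast
    have "norm (v (Suc k) - c) \<le> 2 * (\<mu> * norm (critical_return c))"
      using norm_E[OF \<omega>(1) v(2)[of k]] \<beta>(3) unfolding \<omega>(2) by linarith
    then have "norm (v (Suc k) - c) / norm (return_map c (v k)) \<le> 2 * (\<mu> * norm (critical_return c)) / (norm (critical_return c) / 2)"
      using return_map_bounds[OF v(2)[of k]] c(3) \<mu>(1) by (intro frac_le) auto
    also have "\<dots> = 4 * \<mu>" using c(3) by simp
    finally have "real p / real q * (norm (v (Suc k) - c) / norm (return_map c (v k))) \<le> real p / real q * (4 * \<mu>)"
      by (intro mult_left_mono) auto
    then show ?thesis unfolding \<kappa> u_last u_next by simp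
  qed
  define \<theta> where "\<theta> = C ^ (n - 1) * (real p / real q * (4 * \<mu>))"
  have C1: "1 \<le> C" by (simp add: C_def)
  have \<theta>: "0 \<le> \<theta>" "\<theta> < 1" using \<mu> C1 by (auto simp: \<theta>_def)
  have block: "norm (multiplier p q c (\<lambda>i. u (n * k + i)) n) \<le> \<theta>" for k
  proof -
    have "norm (multiplier p q c (\<lambda>i. u (n * k + i)) n) = (\<Prod>i<n. \<kappa> (n * k + i))"
      by (simp add: multiplier_def prod_norm[symmetric] \<kappa>_def)
    also have "{..<n} = insert (n - 1) {..<n - 1}" using n(1) by auto
    also have "(\<Prod>i\<in>insert (n - 1) {..<n - 1}. \<kappa> (n * k + i)) = (\<Prod>i<n - 1. \<kappa> (n * k + i)) * \<kappa> (n * k + (n - 1))"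
      by simp
    also have "(\<Prod>i<n - 1. \<kappa> (n * k + i)) \<le> (\<Prod>i<n - 1. C)"
    proof (intro prod_mono conjI)
      fix i assume "i \<in> {..<n - 1}"
      then show "\<kappa> (n * k + i) \<le> C" by (intro \<kappa>C) auto
    qed (simp add: \<kappa>_def)
    then have "(\<Prod>i<n - 1. \<kappa> (n * k + i)) * \<kappa> (n * k + (n - 1)) \<le> (\<Prod>i<n - 1. C) * (real p / real q * (4 * \<mu>))"
      using \<kappa>last[of k] C1 by (intro mult_mono) (auto simp: \<kappa>_def prod_nonneg)
    finally show ?thesis by (simp add: \<theta>_def)
  qed
  have "norm (multiplier p q c u (n * k)) \<le> \<theta> ^ k" for k
  proof (induction k)
    case (Suc k)
    have "multiplier p q c u (n * Suc k) = multiplier p q c u (n * k) * multiplier p q c (\<lambda>i. u (n * k + i)) n"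
      using multiplier_add[of p q c u "n * k" n] by (simp add: add.commute)
    then have "norm (multiplier p q c u (n * Suc k)) \<le> \<theta> ^ k * \<theta>"
      unfolding norm_mult using Suc block[of k] \<theta> by (simp add: norm_mult mult_mono)
    then show ?case by (simp add: mult.commute)
  qed (simp add: multiplier_def)
  moreover have "\<theta> ^ N < 1" using \<theta> N by (intro power_less_one_iff[THEN iffD2]) auto
  ultimately have "norm (multiplier p q c u (n * N)) < 1" by (meson le_less_trans)
  then have "attracting_cycle p q c u" unfolding attracting_cycle_iff[OF q p] using cyc nz by blast
  moreover have "\<forall>i<n. u i = follow c i x" using v(1) by (simp add: u_def)
  ultimately show ?thesis by blast
qed

lemma attracting_union:
  assumes "2 \<le> q"
  shows "\<Union>{range w |w. attracting_cycle p q c w} = (\<Union>i<n. follow c i ` Fix)"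
proof
  show "\<Union>{range w |w. attracting_cycle p q c w} \<subseteq> (\<Union>i<n. follow c i ` Fix)"
    using attracting_cycle_subset[OF assms] by blast
  show "(\<Union>i<n. follow c i ` Fix) \<subseteq> \<Union>{range w |w. attracting_cycle p q c w}"
  proof
    fix y assume "y \<in> (\<Union>i<n. follow c i ` Fix)"
    then obtain i x where i: "i < n" "x \<in> Fix" "y = follow c i x" by blast
    then obtain u where "attracting_cycle p q c u" "u i = y" using fixpoint_orbit_attracting[OF assms] by metis
    then show "y \<in> \<Union>{range w |w. attracting_cycle p q c w}" by blast
  qed
qed

lemma disjoint_Suc:
  assumes "i < n" "j < n" "i \<noteq> j"
  shows "cball (z (Suc i)) \<rho> \<inter> cball (z (Suc j)) \<rho> = {}"
proof -
  have red: "z (Suc i) = z (Suc i mod n)" if "i < n" for i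
    using that n(2) z_0 by (cases "Suc i = n") auto
  have "Suc i mod n \<noteq> Suc j mod n" using assms by (cases "Suc i = n"; cases "Suc j = n") auto
  then show ?thesis unfolding red[OF assms(1)] red[OF assms(2)] using n(1) by (intro disjoint) auto
qed

lemma cantor_dual_julia:
  assumes "2 \<le> q"
  shows "cantor_set (dual_julia p q c)"
proof -
  interpret separated_ifs E I B "1/2" by (rule ifs[OF assms])
  have near: "dist v a < \<eta>" if "v \<in> closure Fix" for v using B_near limit_set_subset that by blast
  show ?thesis
    unfolding dual_julia_def attracting_union[OF assms]
  proof (rule cantor_set_disjoint_images)
    show "finite {..<n}" "{..<n} \<noteq> {}" using n(1) by auto
    show "compact (closure Fix)" by (rule limit_set_compact)
    show "Fix \<noteq> {}" by (rule limit_set_nonempty)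
    show "x islimpt Fix" if "x \<in> Fix" for x by (rule word_fixpoints_islimpt[OF that])
    show "x = y" if "connected X" "X \<subseteq> closure Fix" "x \<in> X" "y \<in> X" for X x y
      by (rule limit_set_connected_subset_trivial[OF that])
  next
    fix i assume i: "i \<in> {..<n}"
    have "(1 / \<eta>)-lipschitz_on (closure Fix) (follow c i)"
      using follow_lipschitz[OF _ c_near near near, of i] i \<eta> by (intro lipschitz_onI) auto
    then show "continuous_on (closure Fix) (follow c i)" by (rule lipschitz_on_continuous_on)
    show "inj_on (follow c i) (closure Fix)"
      using follow_inj[OF _ c_near near near, of i] i by (intro inj_onI) auto
  next
    fix i j assume ij: "i \<in> {..<n}" "j \<in> {..<n}" "i \<noteq> j"
    have "follow c i ` closure Fix \<subseteq> cball (z (Suc i)) \<rho>" if "i < n" for i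
      using follow_close[OF that c_near near] by (auto simp: dist_commute)
    then show "follow c i ` closure Fix \<inter> follow c j ` closure Fix = {}"
      using disjoint_Suc[of i j] ij by blast
  qed
qed

end

context charts begin

text \<open>The neighbourhood is a small disc around \<open>a\<close> without the finitely many parameters \<open>c \<noteq> a\<close> for which \<open>0\<close>
returns to \<open>0\<close> after \<open>n\<close> steps; so \<open>critical_return c\<close> vanishes in it only for \<open>c = a\<close>.\<close>
lemma nearby_cantor:
  assumes "2 \<le> q"
  shows "\<exists>V. open V \<and> a \<in> V \<and> (\<forall>c\<in>V. c \<noteq> a \<longrightarrow> cantor_set (dual_julia p q c))"
proof -
  obtain K where K: "0 < K" "\<And>u u'. \<lbrakk>norm (u - 1) \<le> 1/2; norm (u' - 1) \<le> 1/2\<rbrakk>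
     \<Longrightarrow> norm (frac_power p q u - frac_power p q u') \<le> K * norm (u - u')"
    by (rule frac_power_Lipschitz) iprover
  obtain \<epsilon> where \<epsilon>: "0 < \<epsilon>" "\<epsilon> \<le> 1/2" "\<And>u. norm (u - 1) \<le> \<epsilon> \<Longrightarrow> norm (frac_power p q u) \<le> 2"
    "\<And>\<omega> u u'. \<lbrakk>\<omega> ^ q = 1; norm (u - 1) \<le> \<epsilon>; norm (u' - 1) \<le> \<epsilon>;
        \<omega> * frac_power p q u = frac_power p q u'\<rbrakk> \<Longrightarrow> \<omega> = 1 \<and> u = u'"
    by (rule frac_power_separation[OF q p]) iprover
  define A where "A = C ^ (n - 1) * (real p / real q)"
  have A: "0 < A" using p q by (auto simp: A_def C_def)
  define \<mu> where "\<mu> = min (min 1 (\<epsilon> * \<eta> / 2)) (min (\<eta> / (2 * K)) (1 / (8 * A)))"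
  have \<mu>: "0 < \<mu>" "\<mu> \<le> 1" "\<mu> \<le> \<epsilon> * \<eta> / 2" "\<mu> \<le> \<eta> / (2 * K)" "\<mu> \<le> 1 / (8 * A)"
    using \<eta> \<epsilon> K A by (auto simp: \<mu>_def)
  have \<mu>K: "\<mu> * K \<le> \<eta> / 2" using \<mu>(4) K(1) by (simp add: field_simps)
  have "A * (4 * \<mu>) < 1" using \<mu>(5) A by (simp add: field_simps)
  then have \<mu>A: "C ^ (n - 1) * (real p / real q * (4 * \<mu>)) < 1" by (simp add: A_def mult.assoc)
  define r where "r = min 1 (min (\<mu> ^ q) (\<eta> / 2))"
  have r: "0 < r" using \<mu> \<eta> by (simp add: r_def)
  obtain \<delta>1 where \<delta>1: "0 < \<delta>1" and enter: "\<And>c w. \<lbrakk>dist c a < \<delta>1; attracting_cycle p q c w\<rbrakk> \<Longrightarrow>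
    \<exists>j. \<forall>k. norm (w (n * k + j)) \<le> r \<and> (\<forall>i\<le>n. dist (w (n * k + i + j)) (z i) \<le> \<rho>)"
    by (rule attracting_cycles_enter[OF r]) iprover
  obtain \<delta>2 where \<delta>2: "0 < \<delta>2" "\<And>c. dist c a < \<delta>2 \<Longrightarrow> norm (critical_return c) \<le> r" using critical_return_small[OF r] by blast
  define Z where "Z = {c. (0, 0) \<in> corr_rel p q c ^^ n} - {a}"
  have "finite Z" using finite_return_parameters[OF q pq, of n] n(1) by (simp add: Z_def)
  define V where "V = ball a (min (min \<delta>1 \<delta>2) (min \<rho> (\<eta> / 2))) - Z"
  have "open V" unfolding V_def using \<open>finite Z\<close> by (intro open_Diff open_ball finite_imp_closed)
  moreover have "a \<in> V" using \<delta>1 \<delta>2 \<rho> \<eta> by (simp add: V_def Z_def)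
  moreover have "cantor_set (dual_julia p q c)" if cV: "c \<in> V" "c \<noteq> a" for c
  proof -
    have d: "dist c a < \<delta>1" "dist c a < \<delta>2" "dist c a < \<rho>" "dist c a < \<eta> / 2"
      using cV by (auto simp: V_def dist_commute)
    have "critical_return c \<noteq> 0" using critical_return_zero_imp_periodic[of c] cV by (auto simp: V_def Z_def)
    have "perturbation p q a z n \<rho> \<eta> c K \<epsilon> \<mu>"
    proof (intro perturbation.intro perturbation_axioms.intro)
      show "charts p q a z n \<rho> \<eta>" by (rule charts_axioms)
      show "C ^ (n - 1) * (real p / real q * (4 * \<mu>)) < 1" by (rule \<mu>A)
      show "\<exists>j. \<forall>k. norm (w (n * k + j)) \<le> min 1 (min (\<mu> ^ q) (\<eta> / 2)) \<and>
        (\<forall>i\<le>n. dist (w (n * k + i + j)) (z i) \<le> \<rho>)" if "attracting_cycle p q c w" for w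
        using enter[OF d(1) that] unfolding r_def .
      show "norm (critical_return c) \<le> 1" "norm (critical_return c) \<le> \<mu> ^ q" using \<delta>2(2)[OF d(2)] by (auto simp: r_def)
      show "critical_return c \<noteq> 0" by fact
      show "norm (frac_power p q u - frac_power p q u') \<le> K * norm (u - u')"
        if "norm (u - 1) \<le> 1/2" "norm (u' - 1) \<le> 1/2" for u u' by (rule K(2)[OF that])
      show "norm (frac_power p q u) \<le> 2" if "norm (u - 1) \<le> \<epsilon>" for u by (rule \<epsilon>(3)[OF that])
      show "\<omega> = 1 \<and> u = u'" if "\<omega> ^ q = 1" "norm (u - 1) \<le> \<epsilon>" "norm (u' - 1) \<le> \<epsilon>"
        "\<omega> * frac_power p q u = frac_power p q u'" for \<omega> u u' by (rule \<epsilon>(4)[OF that])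
    qed (use K(1) \<epsilon>(1,2) \<mu> \<mu>K d in auto)
    then interpret perturbation p q a z n \<rho> \<eta> c K \<epsilon> \<mu> .
    show ?thesis by (rule cantor_dual_julia[OF assms])
  qed
  ultimately show ?thesis by blast
qed

end

section \<open>The dual Julia set at and near the centre\<close>

theorem theorem1p1:
  fixes p q :: nat and a :: complex and z :: "nat \<Rightarrow> complex"
  assumes "1 \<le> q" and "q < p"
    and "{w. forward_orbit p q a w \<and> w 0 = 0 \<and> bounded (range w)} = {z}"
    and "is_cycle p q a z" and "0 \<in> range z"
  shows "finite (dual_julia p q a) \<and>
    (2 \<le> q \<longrightarrow> (\<exists>V. open V \<and> a \<in> V \<and> (\<forall>c\<in>V. c \<noteq> a \<longrightarrow> cantor_set (dual_julia p q c))))"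
proof -
  have z0: "z 0 = 0" using assms(3) by blast
  obtain m where "0 < m" "z (0 + m) = z 0" using assms(4) unfolding is_cycle_def cycle_of_period_def by blast
  then have ex: "\<exists>m>0. z m = 0" using z0 by auto
  define n where "n = (LEAST m. 0 < m \<and> z m = 0)"
  have "0 < n \<and> z n = 0" unfolding n_def using ex by (rule LeastI_ex)
  moreover have "z i \<noteq> 0" if "0 < i" "i < n" for i
    using not_less_Least[of i "\<lambda>m. 0 < m \<and> z m = 0"] that by (auto simp: n_def)
  ultimately interpret simple_centre p q a z n
    using assms(1-3) by unfold_locales auto
  obtain \<rho> \<eta> where "charts p q a z n \<rho> \<eta>" using charts_exist by blast
  then interpret charts p q a z n \<rho> \<eta> .
  show ?thesis using finite_dual_julia_centre nearby_cantor by blast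
qed

end
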